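(* For every rational $\gamma\ge 2$, there exists a randomized algorithm for the MST problem under explorable uncertainty with predictions that is $\min\left\{1+\frac{1}{\gamma}+\xi+\frac{5\,k_h}{|\mathrm{OPT}|},\ \gamma+1\right\}$-competitive (in expectation), where $\xi=\frac{\{\gamma\}(1-\{\gamma\})}{\gamma\lceil\gamma\rceil\lfloor\gamma\rfloor}\le\frac{1}{48}<0.021$ and $\{\gamma\}=\gamma-\lfloor\gamma\rfloor$ denotes the fractional part of $\gamma$.
   Context: MST problem under explorable uncertainty with predictions: a connected (multi)graph $G=(V,E)$; each edge $e$ has unknown true weight $w_e\in\mathbb{R}_+$ and known uncertainty interval $I_e$, either open $(L_e,U_e)\ni w_e$ or trivial $\{w_e\}$ (then $L_e=U_e=w_e$). Querying $e$ reveals $w_e$. $Q\subseteq E$ is a feasible query set if some spanning tree is a minimum spanning tree for every weight assignment equal to $w_e$ on $Q$ and arbitrary in $I_e$ outside $Q$; $\mathrm{OPT}$ is a minimum-cardinality feasible query set. The algorithm queries adaptively until its query set $\mathrm{ALG}$ is feasible, receiving predictions $\hat w_e\in I_e$; a randomized algorithm is $\rho$-competitive if $\mathbb{E}[|\mathrm{ALG}|]\le\rho|\mathrm{OPT}|$ on every instance. Hop distance: for distinct $e,e'$, $k_{e'}(e)=0$ if $w_e$ and $\hat w_e$ lie in the same one of the regions $(-\infty,L_{e'}]$, $(L_{e'},U_{e'})$, $[U_{e'},\infty)$, else $1$; $k_h=\sum_e\sum_{e'\ne e}k_{e'}(e)$. *)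

theory Defs
  imports "HOL-Probability.Probability"
begin

text \<open>
  Everything known in advance: a multigraph (parallel edges and loops are allowed; a loop is an
  edge with one end vertex), the interval bounds and the predicted weights.
\<close>

record ('v, 'e) uncertain_graph =
  verts :: "'v set"
  edges :: "'e set"
  ends :: "'e \<Rightarrow> 'v set"
  lower :: "'e \<Rightarrow> real"
  upper :: "'e \<Rightarrow> real"
  predicted :: "'e \<Rightarrow> real"

fun walk :: "('v, 'e) uncertain_graph \<Rightarrow> 'v \<Rightarrow> 'e list \<Rightarrow> 'v \<Rightarrow> bool" where
  "walk G u [] v \<longleftrightarrow> u \<in> verts G \<and> u = v"
| "walk G u (e # es) v \<longleftrightarrow> e \<in> edges G \<and> (\<exists>x. ends G e = {u, x} \<and> walk G x es v)"

definition connecting :: "('v, 'e) uncertain_graph \<Rightarrow> 'e set \<Rightarrow> bool" where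
  "connecting G F \<longleftrightarrow>
    verts G \<noteq> {} \<and> (\<forall>u\<in>verts G. \<forall>v\<in>verts G. \<exists>es. set es \<subseteq> F \<and> walk G u es v)"

text \<open>A set of edges contains a cycle iff it contains a nonempty closed trail.\<close>

definition cycle_free :: "('v, 'e) uncertain_graph \<Rightarrow> 'e set \<Rightarrow> bool" where
  "cycle_free G F \<longleftrightarrow> \<not> (\<exists>u es. es \<noteq> [] \<and> distinct es \<and> set es \<subseteq> F \<and> walk G u es u)"

definition spanning_tree :: "('v, 'e) uncertain_graph \<Rightarrow> 'e set \<Rightarrow> bool" where
  "spanning_tree G T \<longleftrightarrow> T \<subseteq> edges G \<and> connecting G T \<and> cycle_free G T"

definition minimum_spanning_tree ::
    "('v, 'e) uncertain_graph \<Rightarrow> ('e \<Rightarrow> real) \<Rightarrow> 'e set \<Rightarrow> bool" where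
  "minimum_spanning_tree G w T \<longleftrightarrow>
    spanning_tree G T \<and> (\<forall>T'. spanning_tree G T' \<longrightarrow> sum w T \<le> sum w T')"

definition uncertainty_interval :: "('v, 'e) uncertain_graph \<Rightarrow> 'e \<Rightarrow> real set" where
  "uncertainty_interval G e =
    (if lower G e = upper G e then {lower G e} else {lower G e<..<upper G e})"

definition mst_instance :: "('v, 'e) uncertain_graph \<Rightarrow> ('e \<Rightarrow> real) \<Rightarrow> bool" where
  "mst_instance G w \<longleftrightarrow>
    finite (verts G) \<and> finite (edges G) \<and>
    (\<forall>e\<in>edges G. \<exists>u\<in>verts G. \<exists>v\<in>verts G. ends G e = {u, v}) \<and>
    connecting G (edges G) \<and>
    (\<forall>e\<in>edges G. 0 \<le> w e \<and> w e \<in> uncertainty_interval G e \<and>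
      predicted G e \<in> uncertainty_interval G e)"

definition feasible_query_set ::
    "('v, 'e) uncertain_graph \<Rightarrow> ('e \<Rightarrow> real) \<Rightarrow> 'e set \<Rightarrow> bool" where
  "feasible_query_set G w Q \<longleftrightarrow>
    Q \<subseteq> edges G \<and>
    (\<exists>T. spanning_tree G T \<and>
      (\<forall>w'. (\<forall>e\<in>Q. w' e = w e) \<and> (\<forall>e\<in>edges G - Q. w' e \<in> uncertainty_interval G e)
        \<longrightarrow> minimum_spanning_tree G w' T))"

definition OPT :: "('v, 'e) uncertain_graph \<Rightarrow> ('e \<Rightarrow> real) \<Rightarrow> 'e set" where
  "OPT G w = (ARG_MIN card Q. feasible_query_set G w Q)"

text \<open>
  \<open>hop G w e' e\<close> is $k_{e'}(e)$. For a trivial interval of \<open>e'\<close> the two closed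
  regions overlap in the point \<open>lower G e' = upper G e'\<close>, which counts as lying in both.
\<close>

definition hop :: "('v, 'e) uncertain_graph \<Rightarrow> ('e \<Rightarrow> real) \<Rightarrow> 'e \<Rightarrow> 'e \<Rightarrow> nat" where
  "hop G w e' e =
    (if \<exists>R\<in>{{..lower G e'}, {lower G e'<..<upper G e'}, {upper G e'..}}.
          w e \<in> R \<and> predicted G e \<in> R
     then 0 else 1)"

definition hop_distance :: "('v, 'e) uncertain_graph \<Rightarrow> ('e \<Rightarrow> real) \<Rightarrow> nat" where
  "hop_distance G w = (\<Sum>e\<in>edges G. \<Sum>e'\<in>edges G - {e}. hop G w e' e)"

text \<open>
  A deterministic adaptive algorithm chooses the next edge to query from the input and the partial
  map of the weights revealed so far. The order of the earlier queries need not be an argument,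
  since it is determined by the algorithm and the revealed weights.
\<close>

type_synonym ('v, 'e) query_algorithm =
  "('v, 'e) uncertain_graph \<Rightarrow> ('e \<rightharpoonup> real) \<Rightarrow> 'e"

fun queried :: "('v, 'e) query_algorithm \<Rightarrow> ('v, 'e) uncertain_graph \<Rightarrow> ('e \<Rightarrow> real)
    \<Rightarrow> nat \<Rightarrow> 'e set" where
  "queried A G w 0 = {}"
| "queried A G w (Suc n) =
    (let Q = queried A G w n in
     if feasible_query_set G w Q then Q else insert (A G ((Some \<circ> w) |` Q)) Q)"

definition ALG :: "('v, 'e) query_algorithm \<Rightarrow> ('v, 'e) uncertain_graph \<Rightarrow> ('e \<Rightarrow> real) \<Rightarrow> 'e set"
  where "ALG A G w = (\<Union>n. queried A G w n)"

text \<open>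
  An algorithm that queries something outside the graph, or repeats a query before reaching
  feasibility, never reaches a feasible set and is therefore excluded here.
\<close>

definition solves_mst :: "('v, 'e) query_algorithm \<Rightarrow> bool" where
  "solves_mst A \<longleftrightarrow> (\<forall>G w. mst_instance G w \<longrightarrow> feasible_query_set G w (ALG A G w))"

text \<open>
  A randomized algorithm is a probability distribution over deterministic algorithms, chosen
  independently of the instance. The ratio may depend on the instance.
\<close>

definition competitive ::
    "(('v, 'e) uncertain_graph \<Rightarrow> ('e \<Rightarrow> real) \<Rightarrow> real) \<Rightarrow> ('v, 'e) query_algorithm pmf \<Rightarrow> bool"
  where
  "competitive \<rho> p \<longleftrightarrow>
    (\<forall>A\<in>set_pmf p. solves_mst A) \<and>
    (\<forall>G w. mst_instance G w \<longrightarrow>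
      measure_pmf.expectation p (\<lambda>A. real (card (ALG A G w))) \<le> \<rho> G w * real (card (OPT G w)))"

end

(*
For an integer g >= 2 there is a deterministic algorithm with at most
min {(1 + 1/g) |OPT| + 5 k_h, (g + 1) |OPT|} queries; randomizing between floor(gamma) and
floor(gamma) + 1 with mean gamma gives the theorem, since the mean of 1/g is then 1/gamma + xi.

A query set is feasible iff every unqueried nontrivial edge is certainly in or certainly out of the
minimum spanning tree. This only depends on the hop regions of the queried weights, so replacing
predicted by true weights changes the size of a smallest completion by at most the number of hops.
An unsolved state always has a witness set: at most two edges, known without further queries, one of
which every feasible query set must contain.

The algorithm works in batches. Let P be a smallest completion of the current query set if the
predictions are correct. If |P| >= g, it queries a witness set together with g - 1 further edges of P:
at most g + 1 queries, one of them in OPT, and g of them in P. If |P| < g, it queries P, and if this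
does not solve the instance (so there was a hop), also a witness set.
*)

theory Submission
  imports Defs
begin

text \<open>Fixes only what is known in advance. Weight functions stay parameters of the lemmas, so
  that true, predicted and partly revealed weights can be compared on one graph.\<close>

locale uncertain_mst =
  fixes G :: "('v, 'e) uncertain_graph"
  assumes finite_verts: "finite (verts G)"
    and finite_edges: "finite (edges G)"
    and ends_in: "\<And>e. e \<in> edges G \<Longrightarrow> \<exists>u\<in>verts G. \<exists>v\<in>verts G. ends G e = {u, v}"
    and connecting_edges: "connecting G (edges G)"
    and predicted_in: "\<And>e. e \<in> edges G \<Longrightarrow> predicted G e \<in> uncertainty_interval G e"
begin

abbreviation E where "E \<equiv> edges G"

subsection \<open>Connectivity and exchanges in spanning trees\<close>

definition joined where "joined F u v \<longleftrightarrow> (\<exists>es. set es \<subseteq> F \<and> walk G u es v)"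

lemma walk_end: "walk G u es v \<Longrightarrow> v \<in> verts G"
  by (induction es arbitrary: u) auto

lemma walk_start: "walk G u es v \<Longrightarrow> u \<in> verts G"
  by (cases es) (auto dest!: ends_in simp: doubleton_eq_iff)

lemma walk_append: "walk G u (xs @ ys) v \<longleftrightarrow> (\<exists>x. walk G u xs x \<and> walk G x ys v)"
  by (induction xs arbitrary: u) (auto dest: walk_start)

lemma ends_verts: "e \<in> E \<Longrightarrow> ends G e = {u, v} \<Longrightarrow> u \<in> verts G \<and> v \<in> verts G"
  by (auto dest!: ends_in simp: doubleton_eq_iff)

lemma walk_single: "e \<in> E \<Longrightarrow> ends G e = {u, v} \<Longrightarrow> walk G u [e] v"
  by (auto dest: ends_verts)

lemma walk_rev: "walk G u es v \<Longrightarrow> walk G v (rev es) u"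
proof (induction es arbitrary: u)
  case (Cons e es)
  then obtain x where x: "e \<in> E" "ends G e = {u, x}" "walk G x es v" by auto
  have "walk G x [e] u" using x by (intro walk_single) auto
  with Cons.IH[OF x(3)] show ?case by (auto simp: walk_append)
qed auto

lemma joined_refl: "u \<in> verts G \<Longrightarrow> joined F u u"
  unfolding joined_def by (rule exI[of _ "[]"]) auto

lemma joined_sym: "joined F u v \<Longrightarrow> joined F v u"
  unfolding joined_def by (metis walk_rev set_rev)

lemma joined_trans: "joined F u v \<Longrightarrow> joined F v x \<Longrightarrow> joined F u x"
  unfolding joined_def by (metis walk_append set_append Un_subset_iff)

lemma joined_mono: "joined F u v \<Longrightarrow> F \<subseteq> F' \<Longrightarrow> joined F' u v"
  unfolding joined_def by blast

lemma joined_edge: "e \<in> E \<Longrightarrow> e \<in> F \<Longrightarrow> ends G e = {u, v} \<Longrightarrow> joined F u v"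
  unfolding joined_def using walk_single[of e u v] by (intro exI[of _ "[e]"]) auto

text \<open>Every step of a walk is replaced by a detour in \<open>F'\<close>; this is how a tree
  stays connecting after an exchange.\<close>

lemma joined_replace:
  assumes "joined F x y"
    and "\<And>e u v. e \<in> F \<Longrightarrow> e \<in> E \<Longrightarrow> ends G e = {u, v} \<Longrightarrow> joined F' u v"
  shows "joined F' x y"
proof -
  have "walk G x es y \<Longrightarrow> set es \<subseteq> F \<Longrightarrow> joined F' x y" for es
  proof (induction es arbitrary: x)
    case (Cons e es)
    then obtain z where z: "e \<in> E" "ends G e = {x, z}" "walk G z es y" by auto
    show ?case using Cons.IH[OF z(3)] Cons.prems assms(2)[of e x z] z by (auto intro: joined_trans)
  qed (auto intro: joined_refl)
  then show ?thesis using assms(1) unfolding joined_def by blast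
qed

lemma joined_insert:
  assumes "joined (insert e F) x y" "e \<in> E" "ends G e = {u, v}"
  shows "joined F x y \<or> (joined F x u \<and> joined F v y) \<or> (joined F x v \<and> joined F u y)"
proof -
  have "walk G x es y \<Longrightarrow> set es \<subseteq> insert e F \<Longrightarrow> ?thesis" for es
  proof (induction es arbitrary: x)
    case (Cons g es)
    then obtain z where z: "g \<in> E" "ends G g = {x, z}" "walk G z es y" by auto
    have IH: "joined F z y \<or> (joined F z u \<and> joined F v y) \<or> (joined F z v \<and> joined F u y)"
      using Cons.IH[OF z(3)] Cons.prems by auto
    show ?case
    proof (cases "g = e")
      case True
      then have "(x = u \<and> z = v) \<or> (x = v \<and> z = u)"
        using z assms(3) by (auto simp: doubleton_eq_iff)
      moreover have "joined F x x" "joined F z z"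
        using ends_verts[OF z(1,2)] by (auto intro: joined_refl)
      ultimately show ?thesis using IH by (auto intro: joined_trans)
    next
      case False
      then have "joined F x z" using Cons.prems z by (auto intro: joined_edge)
      with IH show ?thesis by (auto intro: joined_trans)
    qed
  qed (auto intro: joined_refl)
  then show ?thesis using assms(1) unfolding joined_def by blast
qed

text \<open>Membership in the closure of \<open>F\<close> in the graphic matroid. A loop of the
  graph is linked by every \<open>F\<close>.\<close>

definition linked where "linked F e \<longleftrightarrow> (\<exists>u v. ends G e = {u, v} \<and> joined F u v)"

lemma linked_iff: "ends G e = {u, v} \<Longrightarrow> linked F e \<longleftrightarrow> joined F u v"
  unfolding linked_def by (auto simp: doubleton_eq_iff dest: joined_sym)

lemma linked_mono: "linked F e \<Longrightarrow> F \<subseteq> F' \<Longrightarrow> linked F' e"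
  unfolding linked_def by (blast intro: joined_mono)

text \<open>Bridges the gap between arbitrary walks and the closed trails of
  \<open>cycle_free\<close>. Two traversals of one edge are removed with all that lies between them,
  except that one stays if both have the same direction.\<close>

lemma joined_distinct:
  assumes "joined F u v"
  shows "\<exists>es. distinct es \<and> set es \<subseteq> F \<and> walk G u es v"
proof -
  have "walk G u es v \<Longrightarrow> set es \<subseteq> F \<Longrightarrow> ?thesis" for es
  proof (induction "length es" arbitrary: es rule: less_induct)
    case less
    show ?case
    proof (cases "distinct es")
      case False
      then obtain xs ys zs e where es: "es = xs @ [e] @ ys @ [e] @ zs"
        using not_distinct_decomp by blast
      obtain p q r s where w: "walk G u xs p" "walk G p [e] q" "walk G q ys r" "walk G r [e] s"
        "walk G s zs v"
        using less.prems(1) unfolding es walk_append by blast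
      have "ends G e = {p, q}" "ends G e = {r, s}" using w(2,4) by auto
      then have "p = s \<or> q = s" by (auto simp: doubleton_eq_iff)
      then have "walk G u (xs @ zs) v \<or> walk G u (xs @ [e] @ zs) v"
        using w unfolding walk_append by blast
      then show ?thesis using less.hyps[of "xs @ zs"] less.hyps[of "xs @ [e] @ zs"] less.prems(2) es
        by auto
    qed (use less in blast)
  qed
  then show ?thesis using assms unfolding joined_def by blast
qed

lemma cycle_free_iff:
  assumes "F \<subseteq> E"
  shows "cycle_free G F \<longleftrightarrow> (\<forall>e\<in>F. \<not> linked (F - {e}) e)"
proof
  assume cf: "cycle_free G F"
  show "\<forall>e\<in>F. \<not> linked (F - {e}) e"
  proof (intro ballI notI)
    fix e assume e: "e \<in> F" "linked (F - {e}) e"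
    then obtain u v where uv: "ends G e = {u, v}" "joined (F - {e}) u v" unfolding linked_def by auto
    obtain es where es: "distinct es" "set es \<subseteq> F - {e}" "walk G u es v"
      using joined_distinct[OF uv(2)] by blast
    have "walk G v (e # es) v" using es uv e assms by (auto intro!: exI[of _ u])
    moreover have "distinct (e # es)" "set (e # es) \<subseteq> F" using es e by auto
    ultimately show False using cf unfolding cycle_free_def by blast
  qed
next
  assume *: "\<forall>e\<in>F. \<not> linked (F - {e}) e"
  show "cycle_free G F" unfolding cycle_free_def
  proof (intro notI, elim exE conjE)
    fix u es assume es: "es \<noteq> []" "distinct es" "set es \<subseteq> F" "walk G u es u"
    then obtain e es' where [simp]: "es = e # es'" by (cases es) auto
    obtain x where x: "ends G e = {u, x}" "walk G x es' u" using es by auto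
    have "joined (F - {e}) x u" unfolding joined_def using x es by (intro exI[of _ es']) auto
    then have "linked (F - {e}) e" using x(1) by (auto simp: linked_iff dest: joined_sym)
    then show False using * es by auto
  qed
qed

section \<open>Spanning trees: exchange along fundamental cycles and cuts\<close>

lemma connecting_iff:
  "connecting G F \<longleftrightarrow> (\<forall>u\<in>verts G. \<forall>v\<in>verts G. joined F u v)"
  using connecting_edges unfolding connecting_def joined_def by auto

lemma spanning_tree_iff:
  "spanning_tree G T \<longleftrightarrow>
    T \<subseteq> E \<and> (\<forall>u\<in>verts G. \<forall>v\<in>verts G. joined T u v) \<and> (\<forall>e\<in>T. \<not> linked (T - {e}) e)"
  unfolding spanning_tree_def connecting_iff using cycle_free_iff by blast

text \<open>The tree path between the ends of \<open>e\<close> cannot lie inside \<open>F\<close>,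
  as it would link \<open>e\<close>. Any path edge outside \<open>F\<close> is on the fundamental
  cycle of \<open>e\<close> and can be exchanged for it.\<close>

lemma spanning_tree_swap_in:
  assumes T: "spanning_tree G T" and e: "e \<in> E" "e \<notin> T" and F: "\<not> linked F e"
  obtains e' where "e' \<in> T" "e' \<notin> F" "spanning_tree G (insert e (T - {e'}))"
proof -
  obtain u v where uv: "ends G e = {u, v}" "u \<in> verts G" "v \<in> verts G" using ends_in[OF e(1)] by auto
  have TE: "T \<subseteq> E" and con: "\<And>u v. u \<in> verts G \<Longrightarrow> v \<in> verts G \<Longrightarrow> joined T u v"
    and cf: "\<And>e. e \<in> T \<Longrightarrow> \<not> linked (T - {e}) e"
    using T unfolding spanning_tree_iff by auto
  have finT: "finite T" using TE finite_edges finite_subset by blast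
  \<comment> \<open>An inclusion-minimal subset of \<open>T\<close> joining the ends of
    \<open>e\<close> is the edge set of the tree path between them.\<close>
  define M where "M = {S. S \<subseteq> T \<and> joined S u v}"
  have "finite M" "M \<noteq> {}" using con[OF uv(2,3)] finT unfolding M_def by auto
  then obtain S where S: "S \<in> M" "\<And>S'. S' \<in> M \<Longrightarrow> S' \<subseteq> S \<Longrightarrow> S' = S"
    using finite_has_minimal[of M] by metis
  have "\<not> S \<subseteq> F" using F S(1) joined_mono unfolding linked_iff[OF uv(1)] M_def by blast
  then obtain e' where e': "e' \<in> S" "e' \<notin> F" by blast
  have e'T: "e' \<in> T" "e' \<in> E" using e' S(1) TE unfolding M_def by auto
  obtain a0 b0 where ab0: "ends G e' = {a0, b0}" using ends_in[OF e'T(2)] by auto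
  then have ba0: "ends G e' = {b0, a0}" by auto
  have "\<not> joined (S - {e'}) u v" using S(1) S(2)[of "S - {e'}"] e' unfolding M_def by blast
  moreover have "joined (insert e' (S - {e'})) u v"
    using S(1) e' unfolding M_def by (simp add: insert_absorb)
  ultimately have "(joined (S - {e'}) u a0 \<and> joined (S - {e'}) b0 v)
      \<or> (joined (S - {e'}) u b0 \<and> joined (S - {e'}) a0 v)"
    using joined_insert[OF _ e'T(2) ab0] by blast
  moreover have "S - {e'} \<subseteq> T - {e'}" using S(1) unfolding M_def by auto
  ultimately have "(joined (T - {e'}) u a0 \<and> joined (T - {e'}) b0 v)
      \<or> (joined (T - {e'}) u b0 \<and> joined (T - {e'}) a0 v)"
    using joined_mono by blast
  then obtain a b where ab: "ends G e' = {a, b}" "joined (T - {e'}) u a" "joined (T - {e'}) b v"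
    using ab0 ba0 by blast
  have nab: "\<not> joined (T - {e'}) a b" using cf[OF e'T(1)] linked_iff[OF ab(1)] by auto
  then have nuv: "\<not> joined (T - {e'}) u v" using ab joined_sym joined_trans by metis
  let ?T = "insert e (T - {e'})"
  have "joined ?T u v" using e uv by (intro joined_edge) auto
  then have jab: "joined ?T a b"
    using ab(2,3) by (meson joined_mono joined_sym joined_trans subset_insertI)
  have "spanning_tree G ?T" unfolding spanning_tree_iff
  proof (intro conjI ballI notI)
    show "?T \<subseteq> E" using TE e by auto
  next
    fix x y assume "x \<in> verts G" "y \<in> verts G"
    then have "joined T x y" by (rule con)
    then show "joined ?T x y"
    proof (rule joined_replace)
      fix g p q assume g: "g \<in> T" "g \<in> E" "ends G g = {p, q}"
      show "joined ?T p q"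
      proof (cases "g = e'")
        case True
        then show ?thesis using jab linked_iff[OF ab(1), of ?T] linked_iff[OF g(3), of ?T] by auto
      qed (use g in \<open>auto intro: joined_edge\<close>)
    qed
  next
    fix g assume g: "g \<in> ?T" "linked (?T - {g}) g"
    show False
    proof (cases "g = e")
      case True
      then have "?T - {g} = T - {e'}" using e by auto
      then show False using nuv g(2) True linked_iff[OF uv(1)] by auto
    next
      case False
      then have gT: "g \<in> T" "g \<noteq> e'" "g \<in> E" using g TE by auto
      obtain p q where pq: "ends G g = {p, q}" using ends_in[OF gT(3)] by auto
      have eq: "?T - {g} = insert e (T - {e'} - {g})" using False by auto
      have "\<not> joined (T - {e'} - {g}) p q"
        using cf[OF gT(1)] linked_iff[OF pq] joined_mono[of "T - {e'} - {g}" p q "T - {g}"] by blast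
      then have "(joined (T - {e'} - {g}) p u \<and> joined (T - {e'} - {g}) v q)
          \<or> (joined (T - {e'} - {g}) p v \<and> joined (T - {e'} - {g}) u q)"
        using joined_insert[OF _ e(1) uv(1)] g(2) unfolding linked_iff[OF pq] eq by blast
      then have "(joined (T - {e'}) p u \<and> joined (T - {e'}) v q)
          \<or> (joined (T - {e'}) p v \<and> joined (T - {e'}) u q)"
        using joined_mono by (meson Diff_subset)
      moreover have "joined (T - {e'}) p q" using gT pq by (intro joined_edge) auto
      ultimately show False using nuv joined_sym joined_trans by metis
    qed
  qed
  with e'T(1) e'(2) that show ?thesis by blast
qed

text \<open>Removing \<open>e\<close> splits the tree into two components. A walk in
  \<open>F\<close> between the ends of \<open>e\<close> crosses this cut, and a crossing edge
  repairs the tree.\<close>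

lemma spanning_tree_swap_out:
  assumes T: "spanning_tree G T" and e: "e \<in> T" and F: "linked F e" "e \<notin> F"
  obtains e' where "e' \<in> F" "e' \<in> E" "e' \<notin> T" "spanning_tree G (insert e' (T - {e}))"
proof -
  have TE: "T \<subseteq> E" and con: "\<And>u v. u \<in> verts G \<Longrightarrow> v \<in> verts G \<Longrightarrow> joined T u v"
    and cf: "\<And>e. e \<in> T \<Longrightarrow> \<not> linked (T - {e}) e"
    using T unfolding spanning_tree_iff by auto
  have eE: "e \<in> E" using e TE by auto
  obtain u v where uv: "ends G e = {u, v}" "u \<in> verts G" "v \<in> verts G" using ends_in[OF eE] by auto
  let ?D = "T - {e}"
  have nuv: "\<not> joined ?D u v" using cf[OF e] linked_iff[OF uv(1)] by auto
  have "\<exists>e' a b. e' \<in> F \<and> e' \<in> E \<and> ends G e' = {a, b} \<and> joined ?D u a \<and> \<not> joined ?D u b"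
  proof (rule ccontr)
    assume no: "\<not> ?thesis"
    have "walk G a es v \<Longrightarrow> set es \<subseteq> F \<Longrightarrow> joined ?D u a \<Longrightarrow> joined ?D u v" for es a
    proof (induction es arbitrary: a)
      case (Cons g es)
      then obtain z where z: "g \<in> E" "ends G g = {a, z}" "walk G z es v" by auto
      then have "joined ?D u z" using no Cons.prems by auto
      then show ?case using Cons z by auto
    qed auto
    then show False
      using F(1) nuv joined_refl[OF uv(2)] unfolding linked_iff[OF uv(1)] joined_def[of F] by blast
  qed
  then obtain e' a b where e': "e' \<in> F" "e' \<in> E" and ab: "ends G e' = {a, b}"
    and ua: "joined ?D u a" and ub: "\<not> joined ?D u b" by blast
  have nab: "\<not> joined ?D a b" using ua ub joined_trans by blast
  have e'T: "e' \<notin> T"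
  proof
    assume "e' \<in> T"
    then have "joined ?D a b" using e' ab F(2) by (intro joined_edge) auto
    then show False using nab by blast
  qed
  have bV: "b \<in> verts G" using ends_verts[OF e'(2) ab] by auto
  have "joined (insert e ?D) u b" using con[OF uv(2) bV] e by (simp add: insert_absorb)
  then have vb: "joined ?D v b" using joined_insert[OF _ eE uv(1)] ub by blast
  let ?T = "insert e' ?D"
  have "joined ?T a b" using e' ab by (intro joined_edge) auto
  then have juv: "joined ?T u v"
    using ua vb by (meson joined_mono joined_sym joined_trans subset_insertI)
  have "spanning_tree G ?T" unfolding spanning_tree_iff
  proof (intro conjI ballI notI)
    show "?T \<subseteq> E" using TE e' by auto
  next
    fix x y assume "x \<in> verts G" "y \<in> verts G"
    then have "joined T x y" by (rule con)
    then show "joined ?T x y"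
    proof (rule joined_replace)
      fix g p q assume g: "g \<in> T" "g \<in> E" "ends G g = {p, q}"
      show "joined ?T p q"
      proof (cases "g = e")
        case True
        then show ?thesis using juv linked_iff[OF uv(1), of ?T] linked_iff[OF g(3), of ?T] by auto
      qed (use g in \<open>auto intro: joined_edge\<close>)
    qed
  next
    fix g assume g: "g \<in> ?T" "linked (?T - {g}) g"
    show False
    proof (cases "g = e'")
      case True
      then have "?T - {g} = ?D" using e'T by auto
      then show False using nab g(2) True linked_iff[OF ab] by auto
    next
      case False
      then have gT: "g \<in> T" "g \<noteq> e" "g \<in> E" using g TE by auto
      obtain p q where pq: "ends G g = {p, q}" using ends_in[OF gT(3)] by auto
      have eq: "?T - {g} = insert e' (?D - {g})" using False by auto
      have "\<not> joined (?D - {g}) p q"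
        using cf[OF gT(1)] linked_iff[OF pq] joined_mono[of "?D - {g}" p q "T - {g}"] by blast
      then have "(joined (?D - {g}) p a \<and> joined (?D - {g}) b q)
          \<or> (joined (?D - {g}) p b \<and> joined (?D - {g}) a q)"
        using joined_insert[OF _ e'(2) ab] g(2) unfolding linked_iff[OF pq] eq by blast
      then have "(joined ?D p a \<and> joined ?D b q) \<or> (joined ?D p b \<and> joined ?D a q)"
        using joined_mono by (meson Diff_subset)
      moreover have "joined ?D p q" using gT pq by (intro joined_edge) auto
      ultimately show False using nab joined_sym joined_trans by metis
    qed
  qed
  with e' e'T that show ?thesis by blast
qed

lemma spanning_tree_exists: "\<exists>T. spanning_tree G T"
proof -
  define M where "M = {T. T \<subseteq> E \<and> connecting G T}"
  have "finite M" "M \<noteq> {}" using finite_edges connecting_edges unfolding M_def by auto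
  then obtain T where T: "T \<in> M" "\<And>S. S \<in> M \<Longrightarrow> S \<subseteq> T \<Longrightarrow> S = T"
    using finite_has_minimal[of M] by metis
  have "\<not> linked (T - {e}) e" if e: "e \<in> T" for e
  proof
    assume l: "linked (T - {e}) e"
    have "joined (T - {e}) x y" if "x \<in> verts G" "y \<in> verts G" for x y
    proof (rule joined_replace)
      show "joined T x y" using T(1) that unfolding M_def connecting_iff by auto
      show "joined (T - {e}) u v" if "g \<in> T" "g \<in> E" "ends G g = {u, v}" for g u v
        using that l linked_iff[of e u v] by (cases "g = e") (auto intro: joined_edge)
    qed
    then have "T - {e} \<in> M" using T(1) unfolding M_def connecting_iff by auto
    then show False using T(2)[of "T - {e}"] e by auto
  qed
  then show ?thesis using T(1) unfolding spanning_tree_iff M_def connecting_iff by blast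
qed

lemma finite_spanning_trees: "finite {T. spanning_tree G T}"
  by (rule finite_subset[of _ "Pow E"]) (auto simp: spanning_tree_def finite_edges)

lemma minimum_spanning_tree_exists: "\<exists>T. minimum_spanning_tree G w T"
proof -
  have "\<exists>T\<in>{T. spanning_tree G T}. \<forall>S\<in>{T. spanning_tree G T}. sum w T \<le> sum w S"
    using finite_spanning_trees spanning_tree_exists
    by (intro bexI[OF _ arg_min_if_finite(1)[of _ "sum w"]] ballI arg_min_least) auto
  then show ?thesis unfolding minimum_spanning_tree_def by auto
qed

lemma spanning_tree_finite: "spanning_tree G T \<Longrightarrow> finite T"
  using finite_edges finite_subset unfolding spanning_tree_def by blast

lemma sum_swap:
  fixes w :: "'e \<Rightarrow> real"
  assumes "finite T" "e \<in> T" "f \<notin> T"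
  shows "sum w (insert f (T - {e})) = sum w T - w e + w f"
  using assms by (simp add: sum_diff1)

lemma minimum_spanning_tree_swap:
  assumes "minimum_spanning_tree G w T" "e \<in> T" "f \<notin> T" "spanning_tree G (insert f (T - {e}))"
  shows "w e \<le> w f"
  using assms sum_swap[OF spanning_tree_finite, of T e f w]
  unfolding minimum_spanning_tree_def by force

subsection \<open>Feasible query sets\<close>

definition realization where
  "realization w \<longleftrightarrow> (\<forall>e\<in>E. w e \<in> uncertainty_interval G e)"

definition lo where "lo Q w e = (if e \<in> Q then w e else lower G e)"
definition hi where "hi Q w e = (if e \<in> Q then w e else upper G e)"

text \<open>With the weights revealed on \<open>Q\<close>, \<open>e\<close> lies in every (in no) minimum spanning tree. Both conditions
  depend on the weights only through their position relative to the interval of \<open>e\<close>, which is why hop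
  distance measures the effect of prediction errors.\<close>

definition surely_in where
  "surely_in Q w e \<longleftrightarrow> \<not> linked {e' \<in> E - {e}. lo Q w e' < upper G e} e"

definition surely_out where
  "surely_out Q w e \<longleftrightarrow> linked {e' \<in> E - {e}. hi Q w e' \<le> lower G e} e"

lemma realization_bounds:
  assumes "realization w" "e \<in> E"
  shows "lower G e \<le> w e" "w e \<le> upper G e"
    "lower G e \<noteq> upper G e \<Longrightarrow> lower G e < w e \<and> w e < upper G e"
    "lower G e = upper G e \<Longrightarrow> w e = lower G e"
  using assms unfolding realization_def uncertainty_interval_def
  by (force split: if_splits)+

lemma lo_le: "realization w \<Longrightarrow> e \<in> E \<Longrightarrow> lo Q w e \<le> w e"
  and hi_ge: "realization w \<Longrightarrow> e \<in> E \<Longrightarrow> w e \<le> hi Q w e"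
  using realization_bounds[of w e] by (auto simp: lo_def hi_def)

lemma lo_cong: "\<forall>e\<in>Q. w' e = w e \<Longrightarrow> lo Q w' e = lo Q w e"
  and hi_cong: "\<forall>e\<in>Q. w' e = w e \<Longrightarrow> hi Q w' e = hi Q w e"
  by (auto simp: lo_def hi_def)

text \<open>An open interval does not attain its lower limit, but a hypothetical weight can undercut
  any \<open>x\<close> above that limit without contradicting the revealed values.\<close>

lemma lo_approx:
  assumes "realization w" "e \<in> E" "lo Q w e < x"
  shows "\<exists>y<x. y \<in> uncertainty_interval G e \<and> (e \<in> Q \<longrightarrow> y = w e)"
proof (cases "e \<in> Q \<or> lower G e = upper G e")
  case True
  then show ?thesis using assms realization_bounds[OF assms(1,2)]
    by (intro exI[of _ "w e"]) (auto simp: lo_def realization_def split: if_splits)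
next
  case False
  then have "lower G e < min x (upper G e)" using assms realization_bounds[OF assms(1,2)]
    by (auto simp: lo_def)
  then obtain y where "lower G e < y" "y < min x (upper G e)" using dense by blast
  then show ?thesis using False by (intro exI[of _ y]) (auto simp: uncertainty_interval_def)
qed

lemma hi_approx:
  assumes "realization w" "e \<in> E" "hi Q w e > x"
  shows "\<exists>y>x. y \<in> uncertainty_interval G e \<and> (e \<in> Q \<longrightarrow> y = w e)"
proof (cases "e \<in> Q \<or> lower G e = upper G e")
  case True
  then show ?thesis using assms realization_bounds[OF assms(1,2)]
    by (intro exI[of _ "w e"]) (auto simp: hi_def realization_def split: if_splits)
next
  case False
  then have "max x (lower G e) < upper G e" using assms realization_bounds[OF assms(1,2)]
    by (auto simp: hi_def)
  then obtain y where "max x (lower G e) < y" "y < upper G e" using dense by blast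
  then show ?thesis using False by (intro exI[of _ y]) (auto simp: uncertainty_interval_def)
qed

text \<open>If \<open>e\<close> were missing, it could replace a tree edge of weight at least
  \<open>upper G e\<close>; since the interval is open, that exchange is strictly
  profitable.\<close>

lemma surely_in_mst:
  assumes "realization w'" "\<forall>e\<in>Q. w' e = w e" "e \<in> E" "lower G e < upper G e"
    and "surely_in Q w e" "minimum_spanning_tree G w' T"
  shows "e \<in> T"
proof (rule ccontr)
  assume e: "e \<notin> T"
  have T: "spanning_tree G T" using assms(6) unfolding minimum_spanning_tree_def by auto
  obtain e' where e': "e' \<in> T" "e' \<notin> {e' \<in> E - {e}. lo Q w e' < upper G e}"
    "spanning_tree G (insert e (T - {e'}))"
    using spanning_tree_swap_in[OF T assms(3) e] assms(5) unfolding surely_in_def by blast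
  have e'E: "e' \<in> E" "e' \<noteq> e" using e' e T unfolding spanning_tree_def by auto
  then have "w' e < w' e'"
    using e'(2) realization_bounds[OF assms(1,3)] lo_le[OF assms(1), of e' Q] assms(4)
      lo_cong[OF assms(2)] by auto
  with minimum_spanning_tree_swap[OF assms(6) e'(1) e e'(3)] show False by auto
qed

lemma surely_out_mst:
  assumes "realization w'" "\<forall>e\<in>Q. w' e = w e" "e \<in> E" "lower G e < upper G e"
    and "surely_out Q w e" "minimum_spanning_tree G w' T"
  shows "e \<notin> T"
proof
  assume e: "e \<in> T"
  have T: "spanning_tree G T" using assms(6) unfolding minimum_spanning_tree_def by auto
  obtain e' where e': "e' \<in> {e' \<in> E - {e}. hi Q w e' \<le> lower G e}" "e' \<notin> T"
    "spanning_tree G (insert e' (T - {e}))"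
    using spanning_tree_swap_out[OF T e] assms(5) unfolding surely_out_def by blast
  then have "w' e' < w' e"
    using realization_bounds[OF assms(1,3)] hi_ge[OF assms(1), of e' Q] assms(4)
      hi_cong[OF assms(2)] by auto
  with minimum_spanning_tree_swap[OF assms(6) e e'(2,3)] show False by auto
qed

lemma feasible_query_setE:
  assumes "feasible_query_set G w Q"
  obtains T where "spanning_tree G T"
    "\<And>w'. (\<forall>e\<in>Q. w' e = w e) \<Longrightarrow> (\<forall>e\<in>E - Q. w' e \<in> uncertainty_interval G e)
        \<Longrightarrow> minimum_spanning_tree G w' T"
  using assms unfolding feasible_query_set_def by (elim conjE exE) (erule that, simp)

text \<open>Adversary argument: for an undetermined \<open>e\<close> there is an exchange partner
  \<open>e'\<close> whose order relative to \<open>e\<close> is still open, and suitable weights of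
  these two edges make the fixed tree suboptimal.\<close>

lemma feasible_determined:
  assumes w: "realization w" and Q: "feasible_query_set G w Q"
    and e: "e \<in> E - Q" "lower G e < upper G e"
  shows "surely_in Q w e \<or> surely_out Q w e"
proof (rule ccontr)
  assume no: "\<not> ?thesis"
  obtain T where T: "spanning_tree G T"
    and min: "\<And>w'. (\<forall>e\<in>Q. w' e = w e) \<Longrightarrow> (\<forall>e\<in>E - Q. w' e \<in> uncertainty_interval G e)
        \<Longrightarrow> minimum_spanning_tree G w' T"
    by (rule feasible_query_setE[OF Q]) (rule that, assumption)
  have mst: "minimum_spanning_tree G (w(e := x, e' := y)) T"
    if "x \<in> uncertainty_interval G e" "y \<in> uncertainty_interval G e'" "e' \<in> Q \<longrightarrow> y = w e'" for x y e'
    using that e w by (intro min) (auto simp: realization_def)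
  show False
  proof (cases "e \<in> T")
    case True
    obtain e' where e': "e' \<in> {e' \<in> E - {e}. lo Q w e' < upper G e}" "e' \<notin> T"
      "spanning_tree G (insert e' (T - {e}))"
      using spanning_tree_swap_out[OF T True] no unfolding surely_in_def by blast
    then have "max (lo Q w e') (lower G e) < upper G e" using e by auto
    then obtain x where x: "lo Q w e' < x" "lower G e < x" "x < upper G e"
      using dense[of "max (lo Q w e') (lower G e)" "upper G e"] by auto
    obtain y where y: "y < x" "y \<in> uncertainty_interval G e'" "e' \<in> Q \<longrightarrow> y = w e'"
      using lo_approx[OF w _ x(1)] e' by auto
    show False
      using minimum_spanning_tree_swap[OF mst[of x y e'] True e'(2,3)] x y e' e
      by (auto simp: uncertainty_interval_def split: if_splits)
  next
    case False
    obtain e' where e': "e' \<in> T" "e' \<notin> {e' \<in> E - {e}. hi Q w e' \<le> lower G e}"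
      "spanning_tree G (insert e (T - {e'}))"
      using spanning_tree_swap_in[OF T _ False] no e unfolding surely_out_def by blast
    then have e'E: "e' \<in> E" "e' \<noteq> e" using False T by (auto simp: spanning_tree_def)
    then have "lower G e < min (hi Q w e') (upper G e)" using e e' by auto
    then obtain x where x: "x < hi Q w e'" "lower G e < x" "x < upper G e"
      using dense[of "lower G e" "min (hi Q w e') (upper G e)"] by auto
    obtain y where y: "x < y" "y \<in> uncertainty_interval G e'" "e' \<in> Q \<longrightarrow> y = w e'"
      using hi_approx[OF w _ x(1)] e'E by auto
    show False
      using minimum_spanning_tree_swap[OF mst[of x y e'] e'(1) False e'(3)] x y e'E e
      by (auto simp: uncertainty_interval_def split: if_splits)
  qed
qed

text \<open>Let \<open>T\<close> and \<open>S\<close> be optimal for \<open>w\<close> and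
  \<open>w'\<close>. They agree on the unknown edges, as these are all determined, and elsewhere the
  two weights coincide; so the optimality of \<open>T\<close> carries over to
  \<open>w'\<close>.\<close>

lemma determined_feasible:
  assumes w: "realization w" and Q: "Q \<subseteq> E"
    and det: "\<And>e. e \<in> E - Q \<Longrightarrow> lower G e < upper G e \<Longrightarrow> surely_in Q w e \<or> surely_out Q w e"
  shows "feasible_query_set G w Q"
proof -
  obtain T where T: "minimum_spanning_tree G w T" using minimum_spanning_tree_exists by blast
  have "minimum_spanning_tree G w' T"
    if w': "\<forall>e\<in>Q. w' e = w e" "\<forall>e\<in>E - Q. w' e \<in> uncertainty_interval G e" for w'
  proof -
    have r': "realization w'" using w w' unfolding realization_def by (metis DiffI)
    obtain S where S: "minimum_spanning_tree G w' S" using minimum_spanning_tree_exists by blast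
    define U where "U = {e \<in> E - Q. lower G e < upper G e}"
    have "e \<in> T \<longleftrightarrow> e \<in> S" if "e \<in> U" for e
      using that det[of e] surely_in_mst[OF r' w'(1) _ _ _ S] surely_out_mst[OF r' w'(1) _ _ _ S]
        surely_in_mst[OF w _ _ _ _ T] surely_out_mst[OF w _ _ _ _ T]
      unfolding U_def by blast
    then have TS: "T \<inter> U = S \<inter> U" by blast
    have ST: "spanning_tree G T" "spanning_tree G S"
      using S T unfolding minimum_spanning_tree_def by auto
    have split: "sum v R = sum v (R \<inter> U) + sum v (R - U)" if "spanning_tree G R"
      for v :: "'e \<Rightarrow> real" and R
      by (rule sum.Int_Diff[OF spanning_tree_finite[OF that]])
    have eq: "sum w' (R - U) = sum w (R - U)" if "spanning_tree G R" for R
    proof (rule sum.cong[OF refl])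
      fix e assume e: "e \<in> R - U"
      then have "e \<in> E" using that unfolding spanning_tree_def by auto
      with e show "w' e = w e"
        using w'(1) realization_bounds[OF w, of e] realization_bounds[OF r', of e]
        unfolding U_def by fastforce
    qed
    have "sum w T \<le> sum w S" using T ST unfolding minimum_spanning_tree_def by auto
    then have "sum w' T \<le> sum w' S"
      using split[OF ST(1), of w] split[OF ST(2), of w] split[OF ST(1), of w'] split[OF ST(2), of w']
        eq[OF ST(1)] eq[OF ST(2)] TS by simp
    then show ?thesis using S ST unfolding minimum_spanning_tree_def by (meson order_trans)
  qed
  then show ?thesis using Q T unfolding feasible_query_set_def minimum_spanning_tree_def by blast
qed

lemma feasible_mono:
  assumes "realization w" "feasible_query_set G w Q" "Q \<subseteq> Q'" "Q' \<subseteq> E"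
  shows "feasible_query_set G w Q'"
proof -
  have in_I: "\<forall>e\<in>E - Q. w' e \<in> uncertainty_interval G e"
    if "\<forall>e\<in>Q'. w' e = w e" "\<forall>e\<in>E - Q'. w' e \<in> uncertainty_interval G e" for w'
  proof
    fix e assume "e \<in> E - Q"
    then show "w' e \<in> uncertainty_interval G e"
      using that assms(1) unfolding realization_def by (cases "e \<in> Q'") auto
  qed
  obtain T where T: "spanning_tree G T"
    and min: "\<And>w'. (\<forall>e\<in>Q. w' e = w e) \<Longrightarrow> (\<forall>e\<in>E - Q. w' e \<in> uncertainty_interval G e)
        \<Longrightarrow> minimum_spanning_tree G w' T"
    by (rule feasible_query_setE[OF assms(2)]) (rule that, assumption)
  have "minimum_spanning_tree G w' T"
    if w': "\<forall>e\<in>Q'. w' e = w e" "\<forall>e\<in>E - Q'. w' e \<in> uncertainty_interval G e" for w'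
    using assms(3) w'(1) by (intro min in_I[OF w']) auto
  then show ?thesis using assms(4) T unfolding feasible_query_set_def by (intro conjI exI[of _ T]) auto
qed

lemma feasible_cong: "\<forall>e\<in>Q. w' e = w e \<Longrightarrow> feasible_query_set G w' Q \<longleftrightarrow> feasible_query_set G w Q"
  unfolding feasible_query_set_def by auto

lemma feasible_edges: "realization w \<Longrightarrow> feasible_query_set G w E"
  by (rule determined_feasible) auto

subsection \<open>Witness sets\<close>

text \<open>Quantifying over all realizations that agree with \<open>v\<close> on \<open>Q\<close>
  makes such a set available to the algorithm. It applies to the true and to the predicted weights
  alike.\<close>

definition witness_set where
  "witness_set Q v W \<longleftrightarrow> W \<subseteq> E - Q \<and> card W \<le> 2 \<and>
    (\<forall>w R. realization w \<longrightarrow> (\<forall>e\<in>Q. w e = v e) \<longrightarrow> feasible_query_set G w (Q \<union> R) \<longrightarrow> R \<inter> W \<noteq> {})"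

lemma witness_setD:
  "witness_set Q v W \<Longrightarrow> realization w \<Longrightarrow> \<forall>e\<in>Q. w e = v e \<Longrightarrow> feasible_query_set G w (Q \<union> R)
    \<Longrightarrow> R \<inter> W \<noteq> {}"
  unfolding witness_set_def by blast

text \<open>\<open>T\<close> is a minimum spanning tree for the lower limits of the intervals, with ties broken against
  unknown edges. If the interval of a tree edge \<open>e\<close> is not below that of a non-tree edge \<open>f\<close> that can
  replace it, and \<open>e\<close> has the largest upper limit on the cycle of \<open>f\<close>, then either \<open>e\<close> alone is
  mandatory or, for \<open>f\<close> with minimal lower limit, \<open>{e, f}\<close> is a witness set.\<close>

lemma witness_set_exists:
  assumes v: "realization v" and Q: "Q \<subseteq> E" and unsolved: "\<not> feasible_query_set G v Q"
  shows "\<exists>W. witness_set Q v W"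
proof -
  define U where "U = {e \<in> E - Q. lower G e < upper G e}"
  let ?inf = "lo Q v" and ?sup = "hi Q v"
  have U_E: "e \<in> E" and U_bounds: "?inf e = lower G e" "?sup e = upper G e" "lower G e < upper G e"
    if "e \<in> U" for e using that by (auto simp: U_def lo_def hi_def)
  have known: "?inf e = v e \<and> ?sup e = v e" if "e \<in> E - U" for e
    using that realization_bounds[OF v, of e] by (fastforce simp: U_def lo_def hi_def)

  define M where "M = {T. minimum_spanning_tree G ?inf T}"
  have "finite M" "M \<noteq> {}"
    using finite_subset[OF _ finite_spanning_trees, of M] minimum_spanning_tree_exists
    unfolding M_def minimum_spanning_tree_def by auto
  then obtain T where T: "T \<in> M" "\<And>S. S \<in> M \<Longrightarrow> card (T \<inter> U) \<le> card (S \<inter> U)"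
    using arg_min_if_finite(1)[of M "\<lambda>T. card (T \<inter> U)"] arg_min_least[of M _ "\<lambda>T. card (T \<inter> U)"]
    by metis
  have mst: "minimum_spanning_tree G ?inf T" using T unfolding M_def by auto
  then have st: "spanning_tree G T" unfolding minimum_spanning_tree_def by auto
  then have TE: "T \<subseteq> E" and finT: "finite T" using spanning_tree_finite
    unfolding spanning_tree_def by auto

  define pair where
    "pair e f \<longleftrightarrow> e \<in> T \<and> f \<in> E - T \<and> spanning_tree G (insert f (T - {e}))" for e f
  have pair_le: "?inf e \<le> ?inf f" if "pair e f" for e f
    using that minimum_spanning_tree_swap[OF mst] unfolding pair_def by auto
  \<comment> \<open>Exchanging \<open>e\<close> for a known edge at equal cost would give an optimal
    tree with fewer unknown edges.\<close>
  have pair_eq: "f \<in> U" if p: "pair e f" "?inf e = ?inf f" "e \<in> U" for e f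
  proof (rule ccontr)
    assume f: "f \<notin> U"
    have "sum ?inf (insert f (T - {e})) = sum ?inf T"
      using p sum_swap[OF finT, of e f ?inf] unfolding pair_def by auto
    then have "insert f (T - {e}) \<in> M"
      using mst p(1) unfolding M_def minimum_spanning_tree_def pair_def by auto
    then have "card (T \<inter> U) \<le> card (insert f (T - {e}) \<inter> U)" by (rule T(2))
    also have "insert f (T - {e}) \<inter> U = (T \<inter> U) - {e}" using f by auto
    also have "card \<dots> < card (T \<inter> U)"
      using p finT unfolding pair_def by (intro card_Diff1_less) auto
    finally show False by simp
  qed

  \<comment> \<open>The current limits do not rule out that the non-tree edge \<open>f\<close> is
    lighter than \<open>e\<close>.\<close>
  define viol where "viol e f \<longleftrightarrow> pair e f \<and> ?inf f < ?sup e" for e f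
  have viol_U: "e \<in> U" if "viol e f" for e f
  proof (rule ccontr)
    assume "e \<notin> U"
    then have "?sup e = ?inf e" using that TE known[of e] unfolding viol_def pair_def by auto
    then show False using that pair_le unfolding viol_def by force
  qed
  obtain e0 where e0: "e0 \<in> E - Q" "lower G e0 < upper G e0"
    "\<not> surely_in Q v e0" "\<not> surely_out Q v e0"
    using determined_feasible[OF v Q] unsolved by blast
  then have e0U: "e0 \<in> U" unfolding U_def by auto
  have "\<exists>e f. viol e f"
  proof (cases "e0 \<in> T")
    case True
    obtain f where "f \<in> {e' \<in> E - {e0}. ?inf e' < upper G e0}" "f \<notin> T"
      "spanning_tree G (insert f (T - {e0}))"
      using spanning_tree_swap_out[OF st True] e0(3) unfolding surely_in_def by blast
    then have "viol e0 f" using True U_bounds[OF e0U] unfolding viol_def pair_def by auto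
    then show ?thesis by blast
  next
    case False
    obtain e where e: "e \<in> T" "e \<notin> {e' \<in> E - {e0}. ?sup e' \<le> lower G e0}"
      "spanning_tree G (insert e0 (T - {e}))"
      using spanning_tree_swap_in[OF st _ False] e0(1,4) unfolding surely_out_def by blast
    then have "viol e e0" using False U_bounds[OF e0U] e0(1) TE unfolding viol_def pair_def by auto
    then show ?thesis by blast
  qed
  then obtain e1 f1 where v1: "viol e1 f1" by blast

  have max_ex: "\<exists>e. viol e f \<and> (\<forall>e'. pair e' f \<longrightarrow> ?sup e' \<le> ?sup e)" if "viol e f" for e f
  proof -
    define P where "P = {e. pair e f}"
    have P: "finite P" "P \<noteq> {}"
      using that finite_subset[OF _ finT, of P] unfolding P_def viol_def pair_def by auto
    then have "Max (?sup ` P) \<in> ?sup ` P" by (intro Max_in) auto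
    then obtain m where m: "m \<in> P" "?sup m = Max (?sup ` P)" by auto
    then have max: "?sup e' \<le> ?sup m" if "pair e' f" for e' using that P unfolding P_def by auto
    have "viol m f" using that m(1) max[of e] unfolding viol_def P_def by auto
    with max show ?thesis by blast
  qed

  \<comment> \<open>For an unknown \<open>f\<close>, \<open>out_low\<close> shows that only these
    edges can ever be certified not to exceed its lower limit. An unknown edge needs a strictly
    smaller lower limit because its interval is open.\<close>
  define low where
    "low f = {e \<in> E - {f}. (e \<notin> U \<and> ?inf e \<le> ?inf f) \<or> (e \<in> U \<and> ?inf e < ?inf f)}" for f
  have not_low: "\<not> linked (low e) e" if e: "e \<in> T" "e \<in> U" for e
  proof
    assume "linked (low e) e"
    then obtain f where f: "f \<in> low e" "f \<in> E" "f \<notin> T" "spanning_tree G (insert f (T - {e}))"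
      using spanning_tree_swap_out[OF st e(1)] unfolding low_def by blast
    then have "pair e f" using e unfolding pair_def by auto
    then show False using pair_le[of e f] pair_eq[of e f] f(1) e(2) unfolding low_def by auto
  qed
  have w_sup: "w e \<le> ?sup e \<and> (e \<in> U \<longrightarrow> w e < ?sup e) \<and> (e \<notin> U \<longrightarrow> w e = ?inf e)"
    if "realization w" "\<forall>e\<in>Q. w e = v e" "e \<in> E" for w e
    using that realization_bounds[OF that(1,3)] realization_bounds[OF v that(3)]
    by (cases "lower G e = upper G e"; cases "e \<in> Q") (auto simp: U_def lo_def hi_def)
  have out_low: "{e' \<in> E - {e}. hi (Q \<union> R) w e' \<le> lower G e} \<subseteq> low e"
    if w: "realization w" "\<forall>e\<in>Q. w e = v e" and e: "e \<in> U" for w R e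
  proof
    fix e' assume "e' \<in> {e' \<in> E - {e}. hi (Q \<union> R) w e' \<le> lower G e}"
    then have e': "e' \<in> E - {e}" "w e' \<le> lower G e" using hi_ge[OF w(1), of e' "Q \<union> R"] by auto
    show "e' \<in> low e"
    proof (cases "e' \<in> U")
      case True
      then show ?thesis using e' U_bounds[OF e] U_bounds[OF True] realization_bounds[OF w(1), of e']
        unfolding low_def by auto
    next
      case False
      then have "?inf e' = w e'"
        using e' w_sup[OF w, of e'] by auto
      then show ?thesis using e' False U_bounds[OF e] unfolding low_def by auto
    qed
  qed
  show ?thesis
  proof (cases "\<exists>e f. viol e f \<and> (\<forall>e'. pair e' f \<longrightarrow> ?sup e' \<le> ?sup e)
      \<and> (f \<notin> U \<or> upper G f \<le> upper G e)")
    case True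
    then obtain e f where ef: "viol e f" "\<And>e'. pair e' f \<Longrightarrow> ?sup e' \<le> ?sup e"
      "f \<notin> U \<or> upper G f \<le> upper G e" by blast
    have eU: "e \<in> U" using viol_U ef by auto
    have eT: "e \<in> T" and f: "f \<in> E" "f \<notin> T" "f \<noteq> e" and st2: "spanning_tree G (insert f (T - {e}))"
      using ef(1) unfolding viol_def pair_def by auto
    \<comment> \<open>Unless it is queried, \<open>e\<close> is never surely out, by
      \<open>not_low\<close>, and never surely in, because all other edges on the cycle of
      \<open>f\<close> stay below \<open>upper G e\<close>. So \<open>e\<close> alone is
      mandatory.\<close>
    have hit: "R \<inter> {e} \<noteq> {}"
      if w: "realization w" "\<forall>e\<in>Q. w e = v e" and R: "feasible_query_set G w (Q \<union> R)" for w R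
    proof
      assume "R \<inter> {e} = {}"
      then have "surely_in (Q \<union> R) w e \<or> surely_out (Q \<union> R) w e"
        using eU by (intro feasible_determined w R) (auto simp: U_def)
      moreover have "\<not> surely_out (Q \<union> R) w e"
        using not_low[OF eT eU] out_low[OF w eU] linked_mono unfolding surely_out_def by blast
      moreover have "\<not> surely_in (Q \<union> R) w e"
      proof
        assume "surely_in (Q \<union> R) w e"
        then obtain e' where e': "e' \<in> insert f (T - {e})"
          "e' \<notin> {e' \<in> E - {e}. lo (Q \<union> R) w e' < upper G e}"
          "spanning_tree G (insert e (insert f (T - {e}) - {e'}))"
          using spanning_tree_swap_in[OF st2, of e] U_E[OF eU] f(3) unfolding surely_in_def by blast
        have e'E: "e' \<in> E" "e' \<noteq> e" using e'(1) f TE by auto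
        then have ge: "upper G e \<le> w e'" using e'(2) lo_le[OF w(1), of e' "Q \<union> R"] by auto
        show False
        proof (cases "e' = f")
          case True
          then show False
            using ge ef(1,3) w_sup[OF w f(1)] U_bounds[OF eU] U_bounds[of f] unfolding viol_def
            by (cases "f \<in> U") auto
        next
          case False
          then have e'T: "e' \<in> T" using e' by auto
          have "insert e (insert f (T - {e}) - {e'}) = insert f (T - {e'})"
            using False e'E eT by auto
          then have p: "pair e' f" using e'(3) e'T f unfolding pair_def by auto
          show False
          proof (cases "e' \<in> U")
            case True
            then show False using ge ef(2)[OF p] w_sup[OF w e'E(1)] U_bounds[OF eU] by auto
          next
            case False
            then show False
              using ge pair_le[OF p] w_sup[OF w e'E(1)] U_bounds[OF eU] ef(1) unfolding viol_def by auto
          qed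
        qed
      qed
      ultimately show False by blast
    qed
    have "witness_set Q v {e}" unfolding witness_set_def
      using eU by (intro conjI allI impI hit) (auto simp: U_def)
    then show ?thesis ..
  next
    case False
    \<comment> \<open>Now every violating \<open>f\<close> is unknown and has a larger upper limit
      than all tree edges on its cycle. The minimal lower limit is needed for
      \<open>not_low_f\<close>.\<close>
    define N where "N = {f. \<exists>e. viol e f}"
    have N: "finite N" "N \<noteq> {}"
      using v1 finite_subset[OF _ finite_edges, of N] unfolding N_def viol_def pair_def by auto
    then have "Min (?inf ` N) \<in> ?inf ` N" by (intro Min_in) auto
    then obtain f where fN: "f \<in> N" "?inf f = Min (?inf ` N)" by auto
    have f_min: "?inf f \<le> ?inf f'" if "viol e' f'" for e' f'
    proof -
      have "f' \<in> N" using that unfolding N_def by blast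
      then show ?thesis using fN(2) N(1) by simp
    qed
    obtain e where e: "viol e f" "\<And>e'. pair e' f \<Longrightarrow> ?sup e' \<le> ?sup e"
      using fN(1) max_ex unfolding N_def by blast
    then have fU: "f \<in> U" and lt: "upper G e < upper G f" using False by force+
    have eU: "e \<in> U" using viol_U e by auto
    have f: "f \<in> E" "f \<notin> T" "f \<noteq> e" and st2: "spanning_tree G (insert f (T - {e}))"
      using e(1) unfolding viol_def pair_def by auto
    \<comment> \<open>A crossing edge \<open>f'\<close> in \<open>low f\<close> would also violate
      with \<open>e\<close>: an unknown one contradicts the minimality of \<open>f\<close>, a known
      one belongs to the previous case.\<close>
    have not_low_f: "\<not> linked (low f - {e}) f"
    proof
      assume "linked (low f - {e}) f"
      then obtain f' where f': "f' \<in> low f - {e}" "f' \<in> E" "f' \<notin> insert f (T - {e})"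
        "spanning_tree G (insert f' (insert f (T - {e}) - {f}))"
        using spanning_tree_swap_out[OF st2, of f] unfolding low_def by blast
      have "insert f (T - {e}) - {f} = T - {e}" using f by auto
      then have vf': "viol e f'"
        using f' e(1) unfolding viol_def pair_def low_def by auto
      then have "f' \<notin> U" using f_min f'(1) unfolding low_def by force
      moreover obtain e' where "viol e' f'" "\<forall>e''. pair e'' f' \<longrightarrow> ?sup e'' \<le> ?sup e'"
        using max_ex[OF vf'] by blast
      ultimately show False using False by blast
    qed
    \<comment> \<open>While \<open>e\<close> is unqueried, its upper limit exceeds the lower limit
      of \<open>f\<close>, so it cannot help to exclude \<open>f\<close>. All tree edges on the
      cycle of \<open>f\<close> stay below \<open>upper G f\<close>, so \<open>f\<close> is not
      surely in either.\<close>
    have hit: "R \<inter> {e, f} \<noteq> {}"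
      if w: "realization w" "\<forall>e\<in>Q. w e = v e" and R: "feasible_query_set G w (Q \<union> R)" for w R
    proof
      assume disj: "R \<inter> {e, f} = {}"
      then have "surely_in (Q \<union> R) w f \<or> surely_out (Q \<union> R) w f"
        using fU by (intro feasible_determined w R) (auto simp: U_def)
      moreover have "\<not> surely_out (Q \<union> R) w f"
      proof
        assume out: "surely_out (Q \<union> R) w f"
        have "hi (Q \<union> R) w e > lower G f"
          using disj eU e(1) U_bounds[OF eU] U_bounds[OF fU]
          unfolding viol_def U_def by (auto simp: hi_def)
        then have "{e' \<in> E - {f}. hi (Q \<union> R) w e' \<le> lower G f} \<subseteq> low f - {e}"
          using out_low[OF w fU, of R] by auto
        with out show False using not_low_f linked_mono unfolding surely_out_def by blast
      qed
      moreover have "\<not> surely_in (Q \<union> R) w f"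
      proof
        assume "surely_in (Q \<union> R) w f"
        then obtain e' where e': "e' \<in> T"
          "e' \<notin> {e' \<in> E - {f}. lo (Q \<union> R) w e' < upper G f}"
          "spanning_tree G (insert f (T - {e'}))"
          using spanning_tree_swap_in[OF st f(1,2)] unfolding surely_in_def by blast
        then have "pair e' f" "e' \<in> E" "e' \<noteq> f" using f TE unfolding pair_def by auto
        then show False
          using e'(2) e(2)[of e'] w_sup[OF w, of e'] lo_le[OF w(1), of e' "Q \<union> R"] lt
            U_bounds[OF eU] by auto
      qed
      ultimately show False by blast
    qed
    have "witness_set Q v {e, f}" unfolding witness_set_def
      using eU fU by (intro conjI allI impI hit) (auto simp: U_def card_insert_if)
    then show ?thesis ..
  qed
qed

subsection \<open>Remaining optimum and hop distance\<close>

text \<open>For the true weights this is the true remaining optimum, for \<open>mix Q w\<close> the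
  predicted one.\<close>

definition remaining where
  "remaining Q w = (LEAST k. \<exists>R. feasible_query_set G w (Q \<union> R) \<and> card R = k)"

lemma remaining_le: "feasible_query_set G w (Q \<union> R) \<Longrightarrow> remaining Q w \<le> card R"
  unfolding remaining_def by (rule Least_le) auto

lemma remaining_obtain:
  assumes "realization w" "Q \<subseteq> E"
  obtains R where "R \<subseteq> E - Q" "feasible_query_set G w (Q \<union> R)" "card R = remaining Q w"
proof -
  have "\<exists>k R. feasible_query_set G w (Q \<union> R) \<and> card R = k"
    using feasible_edges[OF assms(1)] assms(2) by (auto intro!: exI[of _ E] simp: Un_absorb1)
  then have "\<exists>R. feasible_query_set G w (Q \<union> R) \<and> card R = remaining Q w"
    unfolding remaining_def by (rule LeastI_ex)
  then obtain R where R: "feasible_query_set G w (Q \<union> R)" "card R = remaining Q w" by blast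
  then have RE: "R \<subseteq> E" unfolding feasible_query_set_def by auto
  have f: "feasible_query_set G w (Q \<union> (R - Q))" using R by simp
  have "card (R - Q) \<le> card R" using RE finite_edges finite_subset by (intro card_mono) auto
  then have "card (R - Q) = remaining Q w" using remaining_le[OF f] R(2) by auto
  with f RE that[of "R - Q"] show ?thesis by auto
qed

lemma remaining_pos:
  assumes "realization w" "Q \<subseteq> E" "\<not> feasible_query_set G w Q"
  shows "1 \<le> remaining Q w"
proof -
  obtain R where R: "R \<subseteq> E - Q" "feasible_query_set G w (Q \<union> R)" "card R = remaining Q w"
    using remaining_obtain[OF assms(1,2)] by blast
  then have "R \<noteq> {}" "finite R" using assms(3) finite_edges finite_subset by auto
  then show ?thesis using R(3) card_gt_0_iff[of R] by auto
qed

lemma remaining_mono: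
  assumes "realization w" "Q \<subseteq> E" "B \<subseteq> E"
  shows "remaining (Q \<union> B) w \<le> remaining Q w"
proof -
  obtain R where R: "R \<subseteq> E - Q" "feasible_query_set G w (Q \<union> R)" "card R = remaining Q w"
    using remaining_obtain[OF assms(1,2)] by blast
  have "feasible_query_set G w (Q \<union> B \<union> R)"
    using R assms by (intro feasible_mono[OF assms(1) R(2)]) auto
  then show ?thesis using remaining_le R(3) by force
qed

lemma remaining_witness:
  assumes "realization w" "Q \<subseteq> E" "B \<subseteq> E"
    and hit: "\<And>R. feasible_query_set G w (Q \<union> R) \<Longrightarrow> R \<inter> B \<noteq> {}"
  shows "remaining (Q \<union> B) w < remaining Q w"
proof -
  obtain R where R: "R \<subseteq> E - Q" "feasible_query_set G w (Q \<union> R)" "card R = remaining Q w"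
    using remaining_obtain[OF assms(1,2)] by blast
  have "feasible_query_set G w (Q \<union> B \<union> (R - B))"
    using R assms by (intro feasible_mono[OF assms(1) R(2)]) auto
  then have "remaining (Q \<union> B) w \<le> card (R - B)" by (rule remaining_le)
  also have "\<dots> < card R"
    using hit[OF R(2)] R(1) finite_edges finite_subset by (intro psubset_card_mono) auto
  finally show ?thesis using R(3) by simp
qed

section \<open>Partly revealed weights and the effect of prediction errors\<close>

definition mix where "mix Q w e = (if e \<in> Q then w e else predicted G e)"

lemma mix_cong: "\<forall>e\<in>Q. w e = v e \<Longrightarrow> mix Q w = mix Q v"
  unfolding mix_def by auto

lemma realization_mix: "realization w \<Longrightarrow> realization (mix Q w)"
  using predicted_in unfolding realization_def mix_def by auto

lemma feasible_mix: "feasible_query_set G (mix Q w) Q \<longleftrightarrow> feasible_query_set G w Q"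
  by (rule feasible_cong) (simp add: mix_def)

text \<open>Each hop is charged to the mispredicted edge \<open>e\<close>, not to the edge
  \<open>e'\<close> whose interval it concerns; so the total splits over batches of queried
  edges.\<close>

definition hops where "hops S w = (\<Sum>e\<in>S. \<Sum>e'\<in>E - {e}. hop G w e' e)"

lemma hops_split: "B \<subseteq> S \<Longrightarrow> S \<subseteq> E \<Longrightarrow> hops S w = hops B w + hops (S - B) w"
  unfolding hops_def using finite_subset[OF _ finite_edges] sum.subset_diff[of B S] by (simp add: add.commute)

lemma card_hops:
  assumes "S \<subseteq> E" "S \<subseteq> S'"
  shows "card {e' \<in> E - S'. \<exists>e\<in>S. hop G w e' e \<noteq> 0} \<le> hops S w"
proof -
  have "{e' \<in> E - S'. \<exists>e\<in>S. hop G w e' e \<noteq> 0} \<subseteq> (\<Union>e\<in>S. {e' \<in> E - {e}. hop G w e' e \<noteq> 0})"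
    using assms(2) by auto
  moreover have finS: "finite S" using assms finite_edges finite_subset by auto
  ultimately have "card {e' \<in> E - S'. \<exists>e\<in>S. hop G w e' e \<noteq> 0}
      \<le> card (\<Union>e\<in>S. {e' \<in> E - {e}. hop G w e' e \<noteq> 0})"
    using finite_edges by (intro card_mono) auto
  also have "\<dots> \<le> (\<Sum>e\<in>S. card {e' \<in> E - {e}. hop G w e' e \<noteq> 0})"
    by (rule card_UN_le[OF finS])
  also have "\<dots> \<le> (\<Sum>e\<in>S. \<Sum>e'\<in>E - {e}. hop G w e' e)"
  proof (rule sum_mono)
    fix e
    have "card {e' \<in> E - {e}. hop G w e' e \<noteq> 0} = (\<Sum>e'\<in>{e' \<in> E - {e}. hop G w e' e \<noteq> 0}. 1)"
      by simp
    also have "\<dots> \<le> (\<Sum>e'\<in>{e' \<in> E - {e}. hop G w e' e \<noteq> 0}. hop G w e' e)"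
      by (rule sum_mono) auto
    also have "\<dots> \<le> (\<Sum>e'\<in>E - {e}. hop G w e' e)"
      using finite_edges by (intro sum_mono2) auto
    finally show "card {e' \<in> E - {e}. hop G w e' e \<noteq> 0} \<le> (\<Sum>e'\<in>E - {e}. hop G w e' e)" .
  qed
  finally show ?thesis unfolding hops_def .
qed

lemma hop_zero:
  assumes "hop G w e' e = 0" "lower G e' < upper G e'"
  shows "(w e < upper G e' \<longleftrightarrow> predicted G e < upper G e')
    \<and> (w e \<le> lower G e' \<longleftrightarrow> predicted G e \<le> lower G e')"
  using assms unfolding hop_def by (auto split: if_splits)

text \<open>The certificates of an unqueried edge only compare weights with the ends of its own
  interval, and querying more edges only raises \<open>lo\<close> and lowers
  \<open>hi\<close>.\<close>

lemma feasible_transfer: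
  assumes r: "realization w1" "realization w2" and f: "feasible_query_set G w1 Q1"
    and Q: "Q1 \<subseteq> Q2" "Q2 \<subseteq> E"
    and same: "\<And>e e'. e' \<in> E - Q2 \<Longrightarrow> lower G e' < upper G e' \<Longrightarrow> e \<in> Q1 \<Longrightarrow>
        (w1 e < upper G e' \<longleftrightarrow> w2 e < upper G e') \<and> (w1 e \<le> lower G e' \<longleftrightarrow> w2 e \<le> lower G e')"
  shows "feasible_query_set G w2 Q2"
proof (rule determined_feasible[OF r(2) Q(2)])
  fix e assume e: "e \<in> E - Q2" "lower G e < upper G e"
  have "{e' \<in> E - {e}. lo Q2 w2 e' < upper G e} \<subseteq> {e' \<in> E - {e}. lo Q1 w1 e' < upper G e}"
    using Q(1) same[OF e] realization_bounds(1)[OF r(2)] by (fastforce simp: lo_def split: if_splits)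
  moreover have "{e' \<in> E - {e}. hi Q1 w1 e' \<le> lower G e} \<subseteq> {e' \<in> E - {e}. hi Q2 w2 e' \<le> lower G e}"
    using Q(1) same[OF e] realization_bounds(2)[OF r(2)] by (fastforce simp: hi_def split: if_splits)
  ultimately show "surely_in Q2 w2 e \<or> surely_out Q2 w2 e"
    using feasible_determined[OF r(1) f, of e] e Q linked_mono
    unfolding surely_in_def surely_out_def by blast
qed

text \<open>The old plan \<open>P\<close> is repaired: what \<open>B\<close> covers is dropped, and
  every edge relative to whose interval some prediction in \<open>B\<close> was wrong is added. Each
  added edge accounts for at least one hop.\<close>

lemma remaining_predicted_step:
  assumes w: "realization w" and Q: "Q \<subseteq> E" and B: "B \<subseteq> E - Q" and P: "P \<subseteq> E"
    and f: "feasible_query_set G (mix Q w) (Q \<union> P)"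
  shows "remaining (Q \<union> B) (mix (Q \<union> B) w) \<le> card (P - B) + hops B w"
proof -
  define N where "N = {e' \<in> E - (Q \<union> B \<union> P). \<exists>e\<in>B. hop G w e' e \<noteq> 0}"
  have "feasible_query_set G (mix (Q \<union> B) w) (Q \<union> B \<union> ((P - B) \<union> N))"
  proof (rule feasible_transfer[OF realization_mix[OF w] realization_mix[OF w] f])
    show "Q \<union> B \<union> ((P - B) \<union> N) \<subseteq> E" using Q B P unfolding N_def by auto
    fix e e' assume *: "e' \<in> E - (Q \<union> B \<union> ((P - B) \<union> N))" "lower G e' < upper G e'" "e \<in> Q \<union> P"
    then have "hop G w e' e = 0" if "e \<in> B" using that unfolding N_def by auto
    then show "(mix Q w e < upper G e' \<longleftrightarrow> mix (Q \<union> B) w e < upper G e')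
        \<and> (mix Q w e \<le> lower G e' \<longleftrightarrow> mix (Q \<union> B) w e \<le> lower G e')"
      using hop_zero[OF _ *(2), of w e] unfolding mix_def by auto
  qed auto
  then have "remaining (Q \<union> B) (mix (Q \<union> B) w) \<le> card ((P - B) \<union> N)" by (rule remaining_le)
  also have "\<dots> \<le> card (P - B) + card N" by (rule card_Un_le)
  also have "card N \<le> hops B w" unfolding N_def using B by (intro card_hops) auto
  finally show ?thesis by simp
qed

text \<open>The same repair turns an optimum for the true weights into a plan for the
  predictions.\<close>

lemma remaining_predicted:
  assumes w: "realization w"
  shows "remaining {} (mix {} w) \<le> remaining {} w + hops E w"
proof -
  obtain P where P: "P \<subseteq> E - {}" "feasible_query_set G w ({} \<union> P)" "card P = remaining {} w"
    using remaining_obtain[OF w] by blast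
  define N where "N = {e' \<in> E - P. \<exists>e\<in>P. hop G w e' e \<noteq> 0}"
  have f: "feasible_query_set G w P" using P(2) by simp
  have "feasible_query_set G (mix {} w) (P \<union> N)"
  proof (rule feasible_transfer[OF w realization_mix[OF w] f])
    show "P \<union> N \<subseteq> E" using P unfolding N_def by auto
    fix e e' assume *: "e' \<in> E - (P \<union> N)" "lower G e' < upper G e'" "e \<in> P"
    then have "hop G w e' e = 0" unfolding N_def by auto
    then show "(w e < upper G e' \<longleftrightarrow> mix {} w e < upper G e')
        \<and> (w e \<le> lower G e' \<longleftrightarrow> mix {} w e \<le> lower G e')"
      using hop_zero[OF _ *(2), of w e] unfolding mix_def by auto
  qed auto
  then have "remaining {} (mix {} w) \<le> card (P \<union> N)" by (intro remaining_le) simp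
  also have "\<dots> \<le> card P + card N" by (rule card_Un_le)
  also have "card N \<le> hops P w" unfolding N_def using P by (intro card_hops) auto
  also have "hops P w \<le> hops E w" using hops_split[of P E w] P(1) by auto
  finally show ?thesis using P(3) by simp
qed

subsection \<open>Adaptive strategies\<close>

text \<open>The iteration of \<open>queried\<close>, made to start from any query set so that
  strategies can be composed.\<close>

definition query_step where
  "query_step a w Q = (if feasible_query_set G w Q then Q else insert (a ((Some \<circ> w) |` Q)) Q)"

lemma queried_eq: "queried A G w n = (query_step (A G) w ^^ n) {}"
  by (induction n) (auto simp: query_step_def Let_def)

lemma query_steps_superset: "Q \<subseteq> (query_step a w ^^ n) Q"
  by (induction n) (auto simp: query_step_def)

lemma query_steps_finite: "finite Q \<Longrightarrow> finite ((query_step a w ^^ n) Q)"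
  by (induction n) (auto simp: query_step_def)

definition solves_within where
  "solves_within a w Q b \<longleftrightarrow> (\<exists>n. feasible_query_set G w ((query_step a w ^^ n) Q) \<and>
    real (card ((query_step a w ^^ n) Q)) \<le> real (card Q) + b)"

text \<open>One strategy must serve all realizations compatible with the answers on
  \<open>Q\<close>; the bound \<open>c w\<close> may refer to unrevealed weights, since only the
  analysis uses it.\<close>

definition achieves where
  "achieves Q v c \<longleftrightarrow>
    (\<exists>a. \<forall>w. realization w \<longrightarrow> (\<forall>e\<in>Q. w e = v e) \<longrightarrow> solves_within a w Q (c w))"

lemma solves_within_mono: "solves_within a w Q b \<Longrightarrow> b \<le> b' \<Longrightarrow> solves_within a w Q b'"
  unfolding solves_within_def by (meson add_left_mono order_trans)

lemma solves_within_nonneg: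
  assumes "solves_within a w Q b" "finite Q"
  shows "0 \<le> b"
proof -
  obtain n where "real (card ((query_step a w ^^ n) Q)) \<le> real (card Q) + b"
    using assms(1) unfolding solves_within_def by blast
  moreover have "card Q \<le> card ((query_step a w ^^ n) Q)"
    using assms(2) by (intro card_mono query_steps_finite query_steps_superset)
  ultimately show ?thesis by linarith
qed

lemma solves_within_solved: "feasible_query_set G w Q \<Longrightarrow> 0 \<le> b \<Longrightarrow> solves_within a w Q b"
  unfolding solves_within_def by (intro exI[of _ 0]) auto

lemma achieves_mono:
  assumes "achieves Q v c" "\<And>w. realization w \<Longrightarrow> \<forall>e\<in>Q. w e = v e \<Longrightarrow> c w \<le> c' w"
  shows "achieves Q v c'"
proof -
  obtain a where
    a: "\<forall>w. realization w \<longrightarrow> (\<forall>e\<in>Q. w e = v e) \<longrightarrow> solves_within a w Q (c w)"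
    using assms(1) unfolding achieves_def ..
  show ?thesis unfolding achieves_def
  proof (intro exI[of _ a] allI impI)
    fix w assume "realization w" "\<forall>e\<in>Q. w e = v e"
    then show "solves_within a w Q (c' w)" using a assms(2) by (blast intro: solves_within_mono)
  qed
qed

lemma achieves_solved:
  assumes "feasible_query_set G v Q" "\<And>w. realization w \<Longrightarrow> \<forall>e\<in>Q. w e = v e \<Longrightarrow> 0 \<le> c w"
  shows "achieves Q v c"
  unfolding achieves_def
proof (intro exI[of _ undefined] allI impI solves_within_solved)
  fix w assume w: "realization w" "\<forall>e\<in>Q. w e = v e"
  show "feasible_query_set G w Q" using assms(1) feasible_cong[OF w(2)] by simp
  show "0 \<le> c w" by (rule assms(2)[OF w])
qed

text \<open>The strategies chosen after the answer \<open>x\<close> to the first query \<open>e\<close> can be glued into one map,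
  because every later state reveals \<open>x\<close> as the value of \<open>e\<close>.\<close>

lemma achieves_query:
  assumes Q: "Q \<subseteq> E" and e: "e \<in> E - Q"
    and ach: "\<And>w. realization w \<Longrightarrow> \<forall>e\<in>Q. w e = v e \<Longrightarrow> achieves (insert e Q) w (\<lambda>w. c w - 1)"
  shows "achieves Q v c"
proof -
  have finQ: "finite Q" using Q finite_edges finite_subset by auto
  have "\<forall>x. \<exists>a. \<forall>w. realization w \<longrightarrow> (\<forall>e\<in>Q. w e = v e) \<longrightarrow> w e = x \<longrightarrow>
      solves_within a w (insert e Q) (c w - 1)"
  proof
    fix x
    show "\<exists>a. \<forall>w. realization w \<longrightarrow> (\<forall>e\<in>Q. w e = v e) \<longrightarrow> w e = x \<longrightarrow>
      solves_within a w (insert e Q) (c w - 1)"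
    proof (cases "\<exists>w. realization w \<and> (\<forall>e\<in>Q. w e = v e) \<and> w e = x")
      case True
      then obtain u where u: "realization u" "\<forall>e\<in>Q. u e = v e" "u e = x" by blast
      obtain a where a: "\<forall>w. realization w \<longrightarrow> (\<forall>e\<in>insert e Q. w e = u e) \<longrightarrow>
          solves_within a w (insert e Q) (c w - 1)"
        using ach[OF u(1,2)] unfolding achieves_def ..
      show ?thesis
      proof (intro exI[of _ a] allI impI)
        fix w assume "realization w" "\<forall>e\<in>Q. w e = v e" "w e = x"
        then show "solves_within a w (insert e Q) (c w - 1)" using u a by auto
      qed
    next
      \<comment> \<open>No realization gives the answer \<open>x\<close>, so any strategy will
        do.\<close>
      case False
      then show ?thesis by (intro exI[of _ undefined]) auto
    qed
  qed
  from choice[OF this] obtain f where f: "\<forall>x w. realization w \<longrightarrow> (\<forall>e\<in>Q. w e = v e) \<longrightarrow> w e = x \<longrightarrow>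
      solves_within (f x) w (insert e Q) (c w - 1)" ..
  \<comment> \<open>The domain equals \<open>Q\<close> only before the first query, since all later
    states contain \<open>e\<close>.\<close>
  define a where "a m = (if dom m = Q then e else f (the (m e)) m)" for m
  show ?thesis unfolding achieves_def
  proof (intro exI[of _ a] allI impI)
    fix w assume w: "realization w" "\<forall>e\<in>Q. w e = v e"
    have *: "solves_within (f (w e)) w (insert e Q) (c w - 1)" using f w by simp
    then obtain n where n: "feasible_query_set G w ((query_step (f (w e)) w ^^ n) (insert e Q))"
      "real (card ((query_step (f (w e)) w ^^ n) (insert e Q))) \<le> real (card (insert e Q)) + (c w - 1)"
      unfolding solves_within_def by auto
    have eq: "(query_step a w ^^ k) (insert e Q) = (query_step (f (w e)) w ^^ k) (insert e Q)" for k
    proof (induction k)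
      case (Suc k)
      define S where "S = (query_step (f (w e)) w ^^ k) (insert e Q)"
      have "insert e Q \<subseteq> S" unfolding S_def by (rule query_steps_superset)
      then have "a ((Some \<circ> w) |` S) = f (w e) ((Some \<circ> w) |` S)"
        using e unfolding a_def by (auto simp: dom_def restrict_map_def)
      then have "query_step a w S = query_step (f (w e)) w S" unfolding query_step_def by simp
      then show ?case using Suc by (simp add: S_def)
    qed simp
    have c: "0 \<le> c w - 1" using solves_within_nonneg[OF *] finQ by simp
    show "solves_within a w Q (c w)"
    proof (cases "feasible_query_set G w Q")
      case True
      then show ?thesis using c by (intro solves_within_solved) auto
    next
      case False
      then have "query_step a w Q = insert e Q"
        unfolding query_step_def a_def by (simp add: dom_def restrict_map_def)
      then have "(query_step a w ^^ Suc n) Q = (query_step (f (w e)) w ^^ n) (insert e Q)"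
        by (simp add: funpow_Suc_right eq del: funpow.simps)
      moreover have "card (insert e Q) = Suc (card Q)" using e finQ by auto
      ultimately show ?thesis using n unfolding solves_within_def by (intro exI[of _ "Suc n"]) auto
    qed
  qed
qed

text \<open>A batch is a sequence of single queries whose answers are ignored until it is complete;
  becoming feasible midway only saves queries.\<close>

lemma achieves_batch:
  assumes "realization v" "Q \<subseteq> E" "S \<subseteq> E - Q"
    and "\<And>w. realization w \<Longrightarrow> \<forall>e\<in>Q. w e = v e \<Longrightarrow>
      achieves (Q \<union> S) w (\<lambda>w. c w - real (card S))"
  shows "achieves Q v c"
proof -
  have "finite S" using assms(3) finite_edges finite_subset by auto
  then show ?thesis using assms
  proof (induction S arbitrary: Q v c rule: finite_induct)
    case empty
    then show ?case using empty.prems(4)[of v] by simp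
  next
    case (insert e S)
    show ?case
    proof (rule achieves_query)
      show "Q \<subseteq> E" "e \<in> E - Q" using insert.prems by auto
      fix w assume w: "realization w" "\<forall>e\<in>Q. w e = v e"
      show "achieves (insert e Q) w (\<lambda>w. c w - 1)"
      proof (rule insert.IH[OF w(1)])
        show "insert e Q \<subseteq> E" "S \<subseteq> E - insert e Q" using insert by auto
        fix u assume u: "realization u" "\<forall>e\<in>insert e Q. u e = w e"
        have "achieves (Q \<union> insert e S) u (\<lambda>w. c w - real (card (insert e S)))"
          using u w by (intro insert.prems(4)) auto
        then show "achieves (insert e Q \<union> S) u (\<lambda>w. c w - 1 - real (card S))"
          using insert.hyps by (simp add: algebra_simps)
      qed
    qed
  qed
qed

subsection \<open>The batch strategy\<close>

lemma min_shift: "a + c \<le> a' \<Longrightarrow> b + c \<le> b' \<Longrightarrow> min a b \<le> min a' b' - (c :: real)"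
  by linarith

text \<open>The constant is \<open>7/2 = 2 + 3/2\<close>: after a prediction error \<open>2\<close> pays for the extra witness set and
  \<open>3/2 \<ge> 1 + 1/g\<close> for the growth of the predicted remaining optimum by one. Passing from the predicted
  to the true optimum at the start costs another \<open>3/2\<close>, which gives \<open>5\<close>.\<close>

definition cost_bound :: "nat \<Rightarrow> 'e set \<Rightarrow> ('e \<Rightarrow> real) \<Rightarrow> real" where
  "cost_bound g Q w = min
    ((1 + 1 / real g) * real (remaining Q (mix Q w)) + 7 / 2 * real (hops (E - Q) w))
    ((real g + 1) * real (remaining Q w))"

text \<open>\<open>cost_bound\<close> serves as a potential: a batch either finishes within the
  bound or lowers both terms of the minimum by at least its size.\<close>

lemma achieves_cost_bound:
  assumes g: "2 \<le> g" and "realization v" "Q \<subseteq> E"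
  shows "achieves Q v (cost_bound g Q)"
  using assms(2,3)
proof (induction "card (E - Q)" arbitrary: Q v rule: less_induct)
  case less
  note v = less.prems(1) and Q = less.prems(2)
  define k where "k = 1 + 1 / real g"
  have k: "k * real g = real g + 1" "1 \<le> k" "k \<le> 3 / 2"
    using g unfolding k_def by (auto simp: field_simps)
  have smaller: "achieves (Q \<union> B) w (cost_bound g (Q \<union> B))"
    if "realization w" "B \<subseteq> E - Q" "B \<noteq> {}" for w B
    using that Q finite_edges by (intro less.hyps psubset_card_mono) auto
  show ?case
  proof (cases "feasible_query_set G v Q")
    case True
    then show ?thesis by (intro achieves_solved) (auto simp: cost_bound_def)
  next
    case unsolved: False
    define p where "p = remaining Q (mix Q v)"
    obtain P where P: "P \<subseteq> E - Q" "feasible_query_set G (mix Q v) (Q \<union> P)" "card P = p"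
      using remaining_obtain[OF realization_mix[OF v] Q] unfolding p_def by blast
    have finP: "finite P" using P finite_edges finite_subset by auto
    have bound_eq: "cost_bound g Q w
        = min (k * real p + 7 / 2 * real (hops (E - Q) w)) ((real g + 1) * real (remaining Q w))"
      if "\<forall>e\<in>Q. w e = v e" for w
      using mix_cong[OF that] unfolding cost_bound_def p_def k_def by simp
    obtain W where wit: "witness_set Q v W" using witness_set_exists[OF v Q unsolved] ..
    then have W: "W \<subseteq> E - Q" "card W \<le> 2" unfolding witness_set_def by auto
    have agree_mix: "\<forall>e\<in>Q. mix Q v e = v e" by (simp add: mix_def)
    \<comment> \<open>The witness property is applied to the predicted weights, which agree with the
      revealed ones on \<open>Q\<close>.\<close>
    have "P \<inter> W \<noteq> {}" by (rule witness_setD[OF wit realization_mix[OF v] agree_mix P(2)])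
    then obtain x where x: "x \<in> P" "x \<in> W" by blast
    show ?thesis
    proof (cases "g \<le> p")
      case True
      \<comment> \<open>Since \<open>x\<close> belongs to both \<open>P\<close> and the witness set,
        \<open>B\<close> will contain \<open>g\<close> edges of \<open>P\<close> but at most
        \<open>g + 1\<close> edges in total.\<close>
      have "g - 1 \<le> card (P - {x})" using True P(3) x finP by auto
      then obtain P' where P': "P' \<subseteq> P - {x}" "card P' = g - 1"
        using obtain_subset_with_card_n by metis
      have finP': "finite P'" using P' finP finite_subset by blast
      define B where "B = P' \<union> W"
      have B: "B \<subseteq> E - Q" "B \<noteq> {}" using P' P W x unfolding B_def by auto
      have "card B \<le> card P' + card W" unfolding B_def by (rule card_Un_le)
      then have cardB: "card B \<le> g + 1" using P' W g by linarith
      have "card (P - B) \<le> card (P - insert x P')"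
        using x finP unfolding B_def by (intro card_mono) auto
      also have "\<dots> = card P - card (insert x P')"
        using P' x finP' by (intro card_Diff_subset) auto
      also have "card (insert x P') = g" using P' finP' g by (subst card_insert_disjoint) auto
      finally have PB: "card (P - B) \<le> p - g" using P(3) by simp
      show ?thesis
      proof (rule achieves_batch[OF v Q B(1)])
        fix w assume w: "realization w" "\<forall>e\<in>Q. w e = v e"
        show "achieves (Q \<union> B) w (\<lambda>w. cost_bound g Q w - real (card B))"
        proof (rule achieves_mono[OF smaller[OF w(1) B]])
          fix u assume u: "realization u" "\<forall>e\<in>Q \<union> B. u e = w e"
          have uv: "\<forall>e\<in>Q. u e = v e" using u w by auto
          have "R \<inter> B \<noteq> {}" if "feasible_query_set G u (Q \<union> R)" for R
            using witness_setD[OF wit u(1) uv that] unfolding B_def by blast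
          then have "remaining (Q \<union> B) u < remaining Q u"
            using B by (intro remaining_witness[OF u(1) Q]) auto
          then have "real (remaining (Q \<union> B) u) + 1 \<le> real (remaining Q u)" by linarith
          then have "(real g + 1) * (real (remaining (Q \<union> B) u) + 1) \<le> (real g + 1) * real (remaining Q u)"
            by (intro mult_left_mono) auto
          then have rob: "(real g + 1) * real (remaining (Q \<union> B) u) + real (card B)
              \<le> (real g + 1) * real (remaining Q u)"
            using cardB by (simp add: distrib_left)
          let ?q = "remaining (Q \<union> B) (mix (Q \<union> B) u)"
          \<comment> \<open>The predicted optimum shrinks by \<open>g\<close> up to hops in
            \<open>B\<close>, and \<open>k * g = g + 1\<close> pays for the batch.\<close>
          have "?q \<le> card (P - B) + hops B u"
            using P B mix_cong[OF uv] by (intro remaining_predicted_step[OF u(1) Q]) auto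
          then have "real ?q \<le> real p - real g + real (hops B u)" using PB True by linarith
          then have "k * real ?q \<le> k * (real p - real g + real (hops B u))"
            using k by (intro mult_left_mono) auto
          also have "\<dots> = k * real p - (real g + 1) + k * real (hops B u)"
            using k(1) by (simp add: algebra_simps)
          also have "k * real (hops B u) \<le> 7 / 2 * real (hops B u)"
            using k by (intro mult_right_mono) auto
          finally have "k * real ?q + real (card B) \<le> k * real p + 7 / 2 * real (hops B u)"
            using cardB by linarith
          moreover have "real (hops (E - Q) u) = real (hops B u) + real (hops (E - (Q \<union> B)) u)"
            using hops_split[of B "E - Q" u] B(1) by (simp add: Diff_eq Int_assoc)
          ultimately have con: "k * real ?q + 7 / 2 * real (hops (E - (Q \<union> B)) u) + real (card B)
              \<le> k * real p + 7 / 2 * real (hops (E - Q) u)"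
            by linarith
          show "cost_bound g (Q \<union> B) u \<le> cost_bound g Q u - real (card B)"
            unfolding bound_eq[OF uv] unfolding cost_bound_def k_def[symmetric]
            by (rule min_shift[OF con rob])
        qed
      qed
    next
      case False
      \<comment> \<open>\<open>P\<close> has at most \<open>g - 1\<close> edges, so together with a
        further witness set it still costs at most \<open>g + 1\<close>.\<close>
      then have pg: "real p + 1 \<le> real g" by linarith
      have QP: "Q \<union> P \<subseteq> E" using Q P by auto
      show ?thesis
      proof (rule achieves_batch[OF v Q P(1)])
        fix w assume w: "realization w" "\<forall>e\<in>Q. w e = v e"
        show "achieves (Q \<union> P) w (\<lambda>w. cost_bound g Q w - real (card P))"
        proof (cases "feasible_query_set G w (Q \<union> P)")
          case True
          show ?thesis
          proof (rule achieves_solved[OF True])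
            fix u assume u: "realization u" "\<forall>e\<in>Q \<union> P. u e = w e"
            have uv: "\<forall>e\<in>Q. u e = v e" using u w by auto
            have "\<not> feasible_query_set G u Q" using unsolved feasible_cong[OF uv] by auto
            then have "1 \<le> remaining Q u" by (rule remaining_pos[OF u(1) Q])
            then have "(real g + 1) * 1 \<le> (real g + 1) * real (remaining Q u)"
              by (intro mult_left_mono) auto
            then have "real p \<le> (real g + 1) * real (remaining Q u)"
              by (rule order_trans[rotated]) (use pg in simp)
            moreover have "1 * real p \<le> k * real p" using k by (intro mult_right_mono) auto
            then have "real p \<le> k * real p + 7 / 2 * real (hops (E - Q) u)" by simp
            ultimately show "0 \<le> cost_bound g Q u - real (card P)"
              unfolding bound_eq[OF uv] P(3) by simp
          qed
        next
          case still: False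
          obtain W' where wit': "witness_set (Q \<union> P) w W'"
            using witness_set_exists[OF w(1) QP still] ..
          then have W': "W' \<subseteq> E - (Q \<union> P)" "card W' \<le> 2" unfolding witness_set_def by auto
          have PW: "P \<union> W' \<subseteq> E - Q" "P \<union> W' \<noteq> {}" using P W' x by auto
          show ?thesis
          proof (rule achieves_batch[OF w(1) QP W'(1)])
            fix w2 assume w2: "realization w2" "\<forall>e\<in>Q \<union> P. w2 e = w e"
            show "achieves (Q \<union> P \<union> W') w2 (\<lambda>w. cost_bound g Q w - real (card P) - real (card W'))"
            proof (rule achieves_mono[OF smaller[OF w2(1) PW, folded Un_assoc]])
              fix u assume u: "realization u" "\<forall>e\<in>Q \<union> P \<union> W'. u e = w2 e"
              have uw: "\<forall>e\<in>Q \<union> P. u e = w e" and uv: "\<forall>e\<in>Q. u e = v e" using u w2 w by auto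
              have "remaining (Q \<union> P \<union> W') u < remaining (Q \<union> P) u"
                using W'(1) by (intro remaining_witness[OF u(1) QP] witness_setD[OF wit' u(1) uw]) auto
              also have "\<dots> \<le> remaining Q u" using P by (intro remaining_mono[OF u(1) Q]) auto
              finally have "real (remaining (Q \<union> P \<union> W') u) + 1 \<le> real (remaining Q u)" by linarith
              then have "(real g + 1) * (real (remaining (Q \<union> P \<union> W') u) + 1)
                  \<le> (real g + 1) * real (remaining Q u)"
                by (intro mult_left_mono) auto
              then have rob: "(real g + 1) * real (remaining (Q \<union> P \<union> W') u) + (real p + real (card W'))
                  \<le> (real g + 1) * real (remaining Q u)"
                using W'(2) pg by (simp add: distrib_left)
              let ?q = "remaining (Q \<union> P \<union> W') (mix (Q \<union> P \<union> W') u)"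
              let ?h = "hops (P \<union> W') u"
              have f: "feasible_query_set G (mix Q u) (Q \<union> P)" using P(2) mix_cong[OF uv] by simp
              \<comment> \<open>The whole plan has been queried, so only repairs forced by hops
                remain.\<close>
              have "remaining (Q \<union> (P \<union> W')) (mix (Q \<union> (P \<union> W')) u) \<le> card (P - (P \<union> W')) + ?h"
                by (rule remaining_predicted_step[OF u(1) Q PW(1) _ f]) (use P(1) in blast)
              moreover have "P - (P \<union> W') = {}" by blast
              ultimately have q: "real ?q \<le> real ?h" by (simp only: Un_assoc card.empty add_0 of_nat_le_iff)
              \<comment> \<open>Under correct predictions \<open>P\<close> would have sufficed, so
                the failure proves a hop in \<open>P\<close>.\<close>
              have "\<not> feasible_query_set G (mix (Q \<union> P) u) (Q \<union> P)"
                using still feasible_cong[OF uw] feasible_mix by auto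
              then have "1 \<le> remaining (Q \<union> P) (mix (Q \<union> P) u)"
                by (rule remaining_pos[OF realization_mix[OF u(1)] QP])
              also have "\<dots> \<le> card (P - P) + hops P u"
                using P(1) by (intro remaining_predicted_step[OF u(1) Q P(1) _ f]) auto
              also have "card (P - P) + hops P u \<le> ?h"
                using hops_split[of P "P \<union> W'" u] PW(1) by (simp add: subset_eq)
              finally have h1: "1 \<le> real ?h" by linarith
              \<comment> \<open>Of \<open>7 / 2 * ?h\<close>, the part \<open>3 / 2 * ?h\<close>
                pays for the new predicted optimum, and \<open>2 * ?h\<close>, which is at least 2,
                pays for \<open>W'\<close>.\<close>
              have "k * real ?q \<le> 3 / 2 * real ?h" using k q by (intro mult_mono) auto
              moreover have "1 * real p \<le> k * real p" using k by (intro mult_right_mono) auto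
              ultimately have "k * real ?q + real p + real (card W') \<le> k * real p + 7 / 2 * real ?h"
                using h1 W'(2) by linarith
              moreover have "real (hops (E - Q) u) = real ?h + real (hops (E - (Q \<union> P \<union> W')) u)"
                using hops_split[of "P \<union> W'" "E - Q" u] PW(1)
                by (simp add: Diff_eq Int_assoc)
              ultimately have con: "k * real ?q + 7 / 2 * real (hops (E - (Q \<union> P \<union> W')) u)
                  + (real p + real (card W')) \<le> k * real p + 7 / 2 * real (hops (E - Q) u)"
                by linarith
              show "cost_bound g (Q \<union> P \<union> W') u
                  \<le> cost_bound g Q u - real (card P) - real (card W')"
                unfolding diff_diff_eq P(3) bound_eq[OF uv] unfolding cost_bound_def k_def[symmetric]
                by (rule min_shift[OF con rob])
            qed
          qed
        qed
      qed
    qed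
  qed
qed

lemma remaining_empty:
  assumes "realization w"
  shows "remaining {} w = card (OPT G w)"
proof -
  have "feasible_query_set G w (OPT G w)"
    unfolding OPT_def by (rule arg_min_natI[of "feasible_query_set G w", OF feasible_edges[OF assms]])
  then have "remaining {} w \<le> card (OPT G w)" by (intro remaining_le) simp
  moreover obtain R where "feasible_query_set G w ({} \<union> R)" "card R = remaining {} w"
    using remaining_obtain[OF assms] by blast
  then have "card (OPT G w) \<le> remaining {} w"
    unfolding OPT_def using arg_min_nat_le[of "feasible_query_set G w" R card] by auto
  ultimately show ?thesis by simp
qed

lemma cost_bound_empty:
  assumes g: "2 \<le> g" and w: "realization w"
  shows "cost_bound g {} w \<le> (1 + 1 / real g) * real (card (OPT G w)) + 5 * real (hop_distance G w)"
    and "cost_bound g {} w \<le> (real g + 1) * real (card (OPT G w))"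
proof -
  define k where "k = 1 + 1 / real g"
  have k: "0 \<le> k" "k \<le> 3 / 2" using g unfolding k_def by (auto simp: field_simps)
  have h: "hops E w = hop_distance G w" unfolding hops_def hop_distance_def ..
  have "real (remaining {} (mix {} w)) \<le> real (card (OPT G w)) + real (hop_distance G w)"
    using remaining_predicted[OF w] unfolding h remaining_empty[OF w] by linarith
  then have "k * real (remaining {} (mix {} w))
      \<le> k * (real (card (OPT G w)) + real (hop_distance G w))"
    using k by (intro mult_left_mono) auto
  also have "\<dots> \<le> k * real (card (OPT G w)) + 3 / 2 * real (hop_distance G w)"
    unfolding distrib_left using k by (intro add_left_mono mult_right_mono) auto
  finally show "cost_bound g {} w
      \<le> (1 + 1 / real g) * real (card (OPT G w)) + 5 * real (hop_distance G w)"
    unfolding cost_bound_def k_def[symmetric] using h by auto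
  show "cost_bound g {} w \<le> (real g + 1) * real (card (OPT G w))"
    unfolding cost_bound_def remaining_empty[OF w] by simp
qed

end

section \<open>From strategies on one graph to query algorithms\<close>

lemma deterministic_algorithm:
  assumes g: "2 \<le> (g :: nat)"
  shows "\<exists>A :: ('v, 'e) query_algorithm. solves_mst A \<and> (\<forall>G w. mst_instance G w \<longrightarrow>
    real (card (ALG A G w)) \<le> (1 + 1 / real g) * real (card (OPT G w)) + 5 * real (hop_distance G w) \<and>
    real (card (ALG A G w)) \<le> (real g + 1) * real (card (OPT G w)))"
proof -
  define good where "good A G w \<longleftrightarrow> (\<exists>n. feasible_query_set G w (queried A G w n) \<and>
      real (card (queried A G w n))
        \<le> (1 + 1 / real g) * real (card (OPT G w)) + 5 * real (hop_distance G w) \<and>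
      real (card (queried A G w n)) \<le> (real g + 1) * real (card (OPT G w)))"
    for A :: "('v, 'e) query_algorithm" and G w
  \<comment> \<open>On \<open>G\<close> only the strategy \<open>A G\<close> matters, so strategies
    can be chosen graph by graph and then combined.\<close>
  have "\<exists>a. \<forall>A w. A G = a \<longrightarrow> mst_instance G w \<longrightarrow> good A G w" for G
  proof (cases "\<exists>w. mst_instance G w")
    case True
    then obtain w0 where w0: "mst_instance G w0" by blast
    then interpret uncertain_mst G unfolding mst_instance_def by unfold_locales blast+
    have real_inst: "realization w" if "mst_instance G w" for w
      using that unfolding mst_instance_def realization_def by auto
    have "achieves {} w0 (cost_bound g {})"
      using real_inst[OF w0] by (intro achieves_cost_bound[OF g]) auto
    then obtain a where a: "\<forall>w. realization w \<longrightarrow> solves_within a w {} (cost_bound g {} w)"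
      unfolding achieves_def by auto
    show ?thesis
    proof (intro exI[of _ a] allI impI)
      fix A w assume A: "A G = a" and "mst_instance G w"
      then have w: "realization w" using real_inst by auto
      obtain n where "feasible_query_set G w ((query_step a w ^^ n) {})"
        "real (card ((query_step a w ^^ n) {})) \<le> cost_bound g {} w"
        using a w unfolding solves_within_def by auto
      then show "good A G w"
        using cost_bound_empty[OF g w] unfolding good_def queried_eq A
        by (intro exI[of _ n]) linarith
    qed
  qed auto
  then have "\<exists>A0. \<forall>G A w. A G = A0 G \<longrightarrow> mst_instance G w \<longrightarrow> good A G w" by (intro choice allI)
  then obtain A where "\<forall>G A' w. A' G = A G \<longrightarrow> mst_instance G w \<longrightarrow> good A' G w" ..
  then have A: "good A G w" if "mst_instance G w" for G w using that by blast
  \<comment> \<open>Once a feasible set is reached, \<open>queried\<close> stays constant, so the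
    union in \<open>ALG\<close> is that set.\<close>
  have ALG: "\<exists>n. feasible_query_set G w (queried A G w n) \<and> ALG A G w = queried A G w n \<and>
      real (card (queried A G w n))
        \<le> (1 + 1 / real g) * real (card (OPT G w)) + 5 * real (hop_distance G w) \<and>
      real (card (queried A G w n)) \<le> (real g + 1) * real (card (OPT G w))"
    if inst: "mst_instance G w" for G w
  proof -
    obtain n where n: "feasible_query_set G w (queried A G w n)"
      "real (card (queried A G w n))
        \<le> (1 + 1 / real g) * real (card (OPT G w)) + 5 * real (hop_distance G w)"
      "real (card (queried A G w n)) \<le> (real g + 1) * real (card (OPT G w))"
      using A[OF inst] unfolding good_def by blast
    have inc: "queried A G w i \<subseteq> queried A G w j" if le: "i \<le> j" for i j
      by (rule lift_Suc_mono_le[OF _ le]) (auto simp: Let_def)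
    have const: "queried A G w (n + i) = queried A G w n" for i
      by (induction i) (use n(1) in \<open>auto simp: Let_def\<close>)
    have "queried A G w i \<subseteq> queried A G w n" for i
      using inc[of i "n + i"] const by auto
    then have "ALG A G w = queried A G w n" unfolding ALG_def by blast
    with n show ?thesis by blast
  qed
  have "solves_mst A" unfolding solves_mst_def using ALG by fastforce
  moreover have "real (card (ALG A G w))
        \<le> (1 + 1 / real g) * real (card (OPT G w)) + 5 * real (hop_distance G w) \<and>
      real (card (ALG A G w)) \<le> (real g + 1) * real (card (OPT G w))"
    if "mst_instance G w" for G w
    using ALG[OF that] by auto
  ultimately show ?thesis by blast
qed

section \<open>Randomizing between two consecutive integer parameters\<close>

theorem theoremF1:
  fixes \<gamma> \<xi> :: real
  assumes "\<gamma> \<in> \<rat>" and "\<gamma> \<ge> 2"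
    and "\<xi> = frac \<gamma> * (1 - frac \<gamma>) / (\<gamma> * of_int \<lceil>\<gamma>\<rceil> * of_int \<lfloor>\<gamma>\<rfloor>)"
  shows "(\<exists>p :: ('v, 'e) query_algorithm pmf.
            competitive
              (\<lambda>G w. min (1 + 1 / \<gamma> + \<xi> + 5 * real (hop_distance G w) / real (card (OPT G w)))
                         (\<gamma> + 1)) p)
         \<and> \<xi> \<le> 1 / 48 \<and> (1 / 48 :: real) < 0.021"
proof -
  define g where "g = nat \<lfloor>\<gamma>\<rfloor>"
  define f where "f = frac \<gamma>"
  have g: "2 \<le> g" and gr: "real_of_int \<lfloor>\<gamma>\<rfloor> = real g" using assms(2) unfolding g_def by linarith+
  have f: "0 \<le> f" "f < 1" unfolding f_def using frac_lt_1 by auto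
  have \<gamma>: "\<gamma> = real g + f" unfolding f_def frac_def gr by simp
  have ceil: "real_of_int \<lceil>\<gamma>\<rceil> = real g + 1" if "f \<noteq> 0"
  proof -
    have "\<lceil>\<gamma>\<rceil> = \<lfloor>\<gamma>\<rfloor> + 1" using that f unfolding f_def frac_def by linarith
    then show ?thesis using gr by simp
  qed
  \<comment> \<open>For integral \<open>\<gamma>\<close> the ceiling is \<open>g\<close> and not
    \<open>g + 1\<close>, but then the numerator vanishes.\<close>
  have \<xi>: "\<xi> = f * (1 - f) / (\<gamma> * (real g + 1) * real g)"
    using assms(3) ceil gr unfolding f_def[symmetric] by (cases "f = 0") auto
  have pos: "0 < real g" "0 < \<gamma>" using g assms(2) by auto
  \<comment> \<open>Taking \<open>g + 1\<close> with probability \<open>f\<close> and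
    \<open>g\<close> otherwise has mean \<open>\<gamma>\<close>. By convexity the mean reciprocal is
    at least \<open>1 / \<gamma>\<close>, and \<open>\<xi>\<close> is exactly the gap.\<close>
  have mean: "f * (1 / (real g + 1)) + (1 - f) * (1 / real g) = 1 / \<gamma> + \<xi>"
    unfolding \<xi> using pos by (simp add: \<gamma> divide_simps) algebra

  have "f * (1 - f) \<le> 1 / 4" using sum_squares_ge_zero[of "f - 1/2" 0] by (simp add: algebra_simps)
  moreover have "12 \<le> \<gamma> * (real g + 1) * real g"
  proof -
    have "2 * 3 \<le> \<gamma> * (real g + 1)" using assms(2) g by (intro mult_mono) auto
    then have "6 * 2 \<le> \<gamma> * (real g + 1) * real g" using g by (intro mult_mono) auto
    then show ?thesis by simp
  qed
  ultimately have "\<xi> \<le> (1 / 4) / 12" unfolding \<xi> by (intro frac_le) auto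
  then have \<xi>_le: "\<xi> \<le> 1 / 48" by simp

  have g1: "2 \<le> g + 1" using g by simp
  from deterministic_algorithm[OF g1] obtain A :: "('v, 'e) query_algorithm" where
    A: "solves_mst A \<and> (\<forall>G w. mst_instance G w \<longrightarrow> real (card (ALG A G w))
        \<le> (1 + 1 / real (g + 1)) * real (card (OPT G w)) + 5 * real (hop_distance G w) \<and>
      real (card (ALG A G w)) \<le> (real (g + 1) + 1) * real (card (OPT G w)))" ..
  from deterministic_algorithm[OF g] obtain B :: "('v, 'e) query_algorithm" where
    B: "solves_mst B \<and> (\<forall>G w. mst_instance G w \<longrightarrow> real (card (ALG B G w))
        \<le> (1 + 1 / real g) * real (card (OPT G w)) + 5 * real (hop_distance G w) \<and>
      real (card (ALG B G w)) \<le> (real g + 1) * real (card (OPT G w)))" ..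
  define p where "p = map_pmf (\<lambda>b. if b then A else B) (bernoulli_pmf f)"
  have "competitive (\<lambda>G w. min (1 + 1 / \<gamma> + \<xi> + 5 * real (hop_distance G w) / real (card (OPT G w)))
                         (\<gamma> + 1)) p"
    unfolding competitive_def
  proof (intro conjI allI impI ballI)
    fix A' assume "A' \<in> set_pmf p"
    then show "solves_mst A'" using A B unfolding p_def by (auto split: if_splits)
  next
    fix G :: "('v, 'e) uncertain_graph" and w assume inst: "mst_instance G w"
    let ?o = "real (card (OPT G w))" and ?h = "real (hop_distance G w)"
    let ?a = "real (card (ALG A G w))" and ?b = "real (card (ALG B G w))"
    have ex: "measure_pmf.expectation p (\<lambda>A. real (card (ALG A G w))) = f * ?a + (1 - f) * ?b"
      unfolding p_def using f by simp
    have "f * ?a + (1 - f) * ?b \<le> f * ((1 + 1 / real (g + 1)) * ?o + 5 * ?h)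
        + (1 - f) * ((1 + 1 / real g) * ?o + 5 * ?h)"
      using f A B inst by (intro add_mono mult_left_mono) auto
    also have "\<dots> = (1 + (f * (1 / (real g + 1)) + (1 - f) * (1 / real g))) * ?o + 5 * ?h"
      by (simp add: algebra_simps)
    finally have con: "f * ?a + (1 - f) * ?b \<le> (1 + 1 / \<gamma> + \<xi>) * ?o + 5 * ?h"
      unfolding mean by (simp add: add.assoc)
    have "f * ?a + (1 - f) * ?b \<le> f * ((real (g + 1) + 1) * ?o) + (1 - f) * ((real g + 1) * ?o)"
      using f A B inst by (intro add_mono mult_left_mono) auto
    also have "\<dots> = (\<gamma> + 1) * ?o" unfolding \<gamma> by (simp add: algebra_simps)
    finally have rob: "f * ?a + (1 - f) * ?b \<le> (\<gamma> + 1) * ?o" .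
    show "measure_pmf.expectation p (\<lambda>A. real (card (ALG A G w)))
        \<le> min (1 + 1 / \<gamma> + \<xi> + 5 * ?h / ?o) (\<gamma> + 1) * ?o"
    \<comment> \<open>If \<open>OPT\<close> is empty, the right-hand side is 0 whatever the value of
      the quotient, and the robust bound shows that no query is expected.\<close>
    proof (cases "?o = 0")
      case False
      then have "(1 + 1 / \<gamma> + \<xi> + 5 * ?h / ?o) * ?o = (1 + 1 / \<gamma> + \<xi>) * ?o + 5 * ?h"
        by (simp add: distrib_right)
      then show ?thesis using con rob unfolding ex by (simp add: min_def)
    qed (use rob ex in auto)
  qed
  then show ?thesis using \<xi>_le by auto
qed

end
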